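(* Let $g=(\sqrt5-1)/2$. (i) The set $\Gamma$ is the disjoint union of the intervals $\Gamma_v$, $v\in\mathscr{F}$. (ii) For any $\alpha\in\Gamma_v$, $v\in\mathscr{F}$, we have $$\underline{b}^\alpha_{[1,|v|]}=v,\quad \overline{b}^\alpha_{[1,|\widehat v|]}={}^{(W)}\widehat v^{(-1)},\quad \overline{b}^\alpha_{|\widehat v|+1}={}^{(W)}\underline{b}^\alpha_{|v|+1},\quad T_\alpha^{|v|+1}(\alpha-1)=T_\alpha^{|\widehat v|+1}(\alpha).$$ (iii) We have $\alpha\in(0,1]\setminus\Gamma$ if and only if $\alpha\in(0,g]$ and the characteristic sequence $a_{[1,\infty)}$ of $\alpha-1$ satisfies $a_{[n,\infty)}\le_{\mathrm{alt}}a_{[1,\infty)}$ for all $n\ge2$. (iv) The set $(0,1]\setminus\Gamma$ is a set of zero Lebesgue measure. For any $\alpha$ in this set, $\overline{b}^\alpha_{[1,\infty)}={}^{(W)}\widehat{\underline{b}^\alpha_{[1,\infty)}}$.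
   Context: For $\alpha\in[0,1]$ let $\mathbb{I}_\alpha=[\alpha-1,\alpha]$ and define $T_\alpha:\mathbb{I}_\alpha\to[\alpha-1,\alpha)$ by $T_\alpha(x)=|1/x|-\lfloor |1/x|+1-\alpha\rfloor$ for $x\neq0$ and $T_\alpha(0)=0$. Put $\varepsilon(x)=+1$ if $x\ge0$, $\varepsilon(x)=-1$ if $x<0$, and $d_\alpha(x)=\lfloor|1/x|+1-\alpha\rfloor$ for $x\ne0$, $d_\alpha(0)=\infty$. For $n\ge1$ set $\underline{b}^\alpha_n=(\varepsilon(y):d_\alpha(y))$ with $y=T_\alpha^{n-1}(\alpha-1)$ and $\overline{b}^\alpha_n=(\varepsilon(z):d_\alpha(z))$ with $z=T_\alpha^{n-1}(\alpha)$. Words. $\mathscr{A}_-=\{(-1:d)\mid d\ge2\}$, $\mathscr{A}_+=\{(+1:d)\mid d\ge1\}$ ($d$ integer), $\mathscr{A}=\mathscr{A}_-\cup\mathscr{A}_+$, $\mathscr{A}_0=\mathscr{A}\cup\{(+1:\infty)\}$. $V^*$ is the set of finite words and $V^\omega$ the set of right-infinite words over $V$; $|v|$ is the length of $v$; $w_{[m,n]}=w_m\cdots w_n$, $w_{[m,n)}=w_m\cdots w_{n-1}$, $w_{[m,\infty)}=w_mw_{m+1}\cdots$ (empty if the index range is empty); $v^\omega=vvv\cdots$. On letters with $d<\infty$: ${}^{(W)}(\varepsilon:d)=(-\varepsilon:d+\varepsilon)$ and $(\varepsilon:d)^{(\pm1)}=(\varepsilon:d\pm1)$; both operations fix $(+1:\infty)$.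 For a (finite or infinite) word $v$, ${}^{(W)}v$ is $v$ with its first letter $v_1$ replaced by ${}^{(W)}v_1$; for a finite nonempty $v$, $v^{(\pm1)}$ is $v$ with its last letter $v_n$ replaced by $v_n^{(\pm1)}$. $\llbracket(\varepsilon_1:d_1)(\varepsilon_2:d_2)\cdots\rrbracket=\dfrac{\varepsilon_1}{d_1+\dfrac{\varepsilon_2}{d_2+\cdots}}$ and $\llbracket(\varepsilon_1:d_1)\cdots(\varepsilon_n:d_n),y\rrbracket=\dfrac{\varepsilon_1}{d_1+\cdots+\dfrac{\varepsilon_n}{d_n+y}}$. Characteristic sequences. The characteristic sequence of $v\in\mathscr{A}_-^*$ is $a_1\cdots a_{2\ell+1}$, where $\ell\ge0$ and $a_j\ge1$ are the integers with $v=(-1:2)^{a_1-1}(-1:2+a_2)(-1:2)^{a_3-1}\cdots(-1:2+a_{2\ell})(-1:2)^{a_{2\ell+1}-1}$; in this case $\widehat v=(-1:2+a_1)(-1:2)^{a_2-1}(-1:2+a_3)\cdots(-1:2)^{a_{2\ell}-1}(-1:2+a_{2\ell+1})$ (so the empty word has characteristic sequence $1$ and $\widehat v=(-1:3)$). For $v\in\mathscr{A}_-^\omega$ not ending with $(-1:2)^\omega$, it is the sequence $a_1a_2\cdots$ of positive integers with $v=(-1:2)^{a_1-1}(-1:2+a_2)(-1:2)^{a_3-1}(-1:2+a_4)\cdots$; then $\widehat v=(-1:2+a_1)(-1:2)^{a_2-1}(-1:2+a_3)(-1:2)^{a_4-1}\cdots$. For $v=(-1:2)^{a_1-1}(-1:2+a_2)(-1:2)^{a_3-1}\cdots(-1:2+a_{2\ell})(-1:2)^\omega$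 it is $a_1a_2\cdots a_{2\ell}\,\infty\,\infty\cdots$. The characteristic sequence of $x\in[-1,0)$ is that of its by-excess expansion, i.e. of the word in $\mathscr{A}_-^\omega$ whose $n$-th letter is $(\varepsilon(T_0^{n-1}(x)):d_0(T_0^{n-1}(x)))$. Alternating order on words of equal length (finite or infinite) over $\{1,2,\dots\}\cup\{\infty\}$: $a<_{\mathrm{alt}}a'$ iff for some $j\ge0$, $a_{[1,j]}=a'_{[1,j]}$ and $(-1)^ja_{j+1}<(-1)^ja'_{j+1}$; $\le_{\mathrm{alt}}$ means $<_{\mathrm{alt}}$ or $=$. $\mathscr{F}$ is the set of $v\in\mathscr{A}_-^*$ whose characteristic sequence $a_{[1,2\ell+1]}$ satisfies $a_{[2j,2\ell+1]}<_{\mathrm{alt}}a_{[1,2\ell-2j+2]}$ and $a_{[2j+1,2\ell+1]}\le_{\mathrm{alt}}a_{[1,2\ell-2j+1]}$ for all $1\le j\le\ell$ (the empty word is in $\mathscr{F}$). For $v\in\mathscr{F}$: $\zeta_v=\llbracket(v\widehat v)^\omega\rrbracket+1$; $\eta_v=\llbracket(v^{(+1)})^\omega\rrbracket+1$ if $|v|\ge1$, $\eta_v=1$ if $|v|=0$; $\Gamma_v=(\zeta_v,\eta_v)$ if $|v|\ge1$, and $\Gamma_v=(g,1]$ if $|v|=0$. $\Gamma=\{\alpha\in(0,1]\mid T_\alpha^n(\alpha-1)\ge0\text{ or }T_\alpha^n(\alpha)\ge0\text{ for some }n\ge1\}$. *)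

theory Defs
  imports "HOL-Analysis.Analysis" "HOL-Library.Stream"
begin

text \<open>\<open>Dig e d\<close> is the letter \<open>(e:d)\<close> with \<open>d\<close> finite, and \<open>Top\<close> is \<open>(+1:\<infinity>)\<close>.
  Finite words are lists and right-infinite words are streams. Streams and lists are indexed
  from 0, so the n-th letter of \<open>w\<close> is \<open>w !! (n - 1)\<close>.\<close>

datatype letter = Dig int int | Top

definition A_minus :: "letter set" where
  "A_minus = {Dig (-1) d | d. d \<ge> 2}"

fun W :: "letter \<Rightarrow> letter" where
  "W (Dig e d) = Dig (- e) (d + e)"
| "W Top = Top"

fun shift_digit :: "int \<Rightarrow> letter \<Rightarrow> letter" where
  "shift_digit k (Dig e d) = Dig e (d + k)"
| "shift_digit k Top = Top"

fun W_word :: "letter list \<Rightarrow> letter list" where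
  "W_word [] = []"
| "W_word (x # xs) = W x # xs"

definition W_stream :: "letter stream \<Rightarrow> letter stream" where
  "W_stream s = W (shd s) ## stl s"

text \<open>\<open>shift_last 1 v\<close> and \<open>shift_last (-1) v\<close> are \<open>v\<close> with exponent \<open>(+1)\<close>
  and \<open>(-1)\<close>, for nonempty \<open>v\<close>.\<close>

definition shift_last :: "int \<Rightarrow> letter list \<Rightarrow> letter list" where
  "shift_last k v = (if v = [] then [] else butlast v @ [shift_digit k (last v)])"

definition T :: "real \<Rightarrow> real \<Rightarrow> real" where
  "T \<alpha> x = (if x = 0 then 0 else \<bar>1 / x\<bar> - of_int \<lfloor>\<bar>1 / x\<bar> + 1 - \<alpha>\<rfloor>)"

definition letter_at :: "real \<Rightarrow> real \<Rightarrow> letter" where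
  "letter_at \<alpha> x =
     (if x = 0 then Top else Dig (if x \<ge> 0 then 1 else -1) \<lfloor>\<bar>1 / x\<bar> + 1 - \<alpha>\<rfloor>)"

definition expansion :: "real \<Rightarrow> real \<Rightarrow> letter stream" where
  "expansion \<alpha> x = smap (letter_at \<alpha>) (siterate (T \<alpha>) x)"

definition lower :: "real \<Rightarrow> letter stream" where
  "lower \<alpha> = expansion \<alpha> (\<alpha> - 1)"

definition upper :: "real \<Rightarrow> letter stream" where
  "upper \<alpha> = expansion \<alpha> \<alpha>"

definition Gam :: "real set" where
  "Gam = {\<alpha>. 0 < \<alpha> \<and> \<alpha> \<le> 1 \<and>
            (\<exists>n\<ge>1. (T \<alpha> ^^ n) (\<alpha> - 1) \<ge> 0 \<or> (T \<alpha> ^^ n) \<alpha> \<ge> 0)}"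

fun cf_fin :: "letter list \<Rightarrow> real" where
  "cf_fin [] = 0"
| "cf_fin (Dig e d # w) = of_int e / (of_int d + cf_fin w)"
| "cf_fin (Top # w) = 0"

definition cf :: "letter stream \<Rightarrow> real" where
  "cf w = lim (\<lambda>n. cf_fin (stake n w))"

text \<open>For \<open>a\<close> of odd length this is
  $(-1:2)^{a_1-1}(-1:2+a_2)(-1:2)^{a_3-1}\cdots(-1:2+a_{2\ell})(-1:2)^{a_{2\ell+1}-1}$;
  for \<open>a\<close> of even length $2\ell$ the word ends with the letter $(-1:2+a_{2\ell})$.\<close>

fun word_of :: "nat list \<Rightarrow> letter list" where
  "word_of [] = []"
| "word_of [a] = replicate (a - 1) (Dig (-1) 2)"
| "word_of (a # b # as) = replicate (a - 1) (Dig (-1) 2) @ Dig (-1) (2 + int b) # word_of as"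

text \<open>For \<open>a\<close> of odd length:
  $(-1:2+a_1)(-1:2)^{a_2-1}(-1:2+a_3)\cdots(-1:2)^{a_{2\ell}-1}(-1:2+a_{2\ell+1})$.\<close>

fun hat_word_of :: "nat list \<Rightarrow> letter list" where
  "hat_word_of [] = []"
| "hat_word_of [a] = [Dig (-1) (2 + int a)]"
| "hat_word_of (a # b # as) =
     Dig (-1) (2 + int a) # replicate (b - 1) (Dig (-1) 2) @ hat_word_of as"

definition is_char_seq :: "letter list \<Rightarrow> nat list \<Rightarrow> bool" where
  "is_char_seq v a \<longleftrightarrow> odd (length a) \<and> (\<forall>x\<in>set a. x \<ge> 1) \<and> v = word_of a"

definition char_seq :: "letter list \<Rightarrow> nat list" where
  "char_seq v = (THE a. is_char_seq v a)"

definition hat :: "letter list \<Rightarrow> letter list" where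
  "hat v = hat_word_of (char_seq v)"

definition word_of_inf :: "nat stream \<Rightarrow> letter stream" where
  "word_of_inf a = flat (smap (\<lambda>j. replicate (a !! (2 * j) - 1) (Dig (-1) 2)
                                    @ [Dig (-1) (2 + int (a !! (2 * j + 1)))]) nats)"

definition hat_word_of_inf :: "nat stream \<Rightarrow> letter stream" where
  "hat_word_of_inf a = flat (smap (\<lambda>j. Dig (-1) (2 + int (a !! (2 * j)))
                                    # replicate (a !! (2 * j + 1) - 1) (Dig (-1) 2)) nats)"

definition ends_with_twos :: "letter stream \<Rightarrow> bool" where
  "ends_with_twos v \<longleftrightarrow> (\<exists>n. sdrop n v = sconst (Dig (-1) 2))"

definition is_char_seq_inf :: "letter stream \<Rightarrow> enat stream \<Rightarrow> bool" where
  "is_char_seq_inf v a \<longleftrightarrow>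
     (\<exists>b. (\<forall>n. b !! n \<ge> 1) \<and> v = word_of_inf b \<and> a = smap enat b) \<or>
     (\<exists>b. even (length b) \<and> (\<forall>x\<in>set b. x \<ge> 1) \<and>
          v = word_of b @- sconst (Dig (-1) 2) \<and> a = map enat b @- sconst \<infinity>)"

definition char_seq_inf :: "letter stream \<Rightarrow> enat stream" where
  "char_seq_inf v = (THE a. is_char_seq_inf v a)"

text \<open>Meaningful only for words over \<open>A_minus\<close> that do not satisfy \<open>ends_with_twos\<close>;
  the entries of their characteristic sequences are finite.\<close>

definition hat_inf :: "letter stream \<Rightarrow> letter stream" where
  "hat_inf v = hat_word_of_inf (smap the_enat (char_seq_inf v))"

definition char_seq_real :: "real \<Rightarrow> enat stream" where
  "char_seq_real x = char_seq_inf (expansion 0 x)"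

text \<open>The condition $(-1)^j a_{j+1} < (-1)^j a'_{j+1}$ is \<open>a\<^sub>j\<^sub>+\<^sub>1 < a'\<^sub>j\<^sub>+\<^sub>1\<close> for even \<open>j\<close>
  and the reverse inequality for odd \<open>j\<close>.\<close>

definition alt_less :: "'a::linorder list \<Rightarrow> 'a list \<Rightarrow> bool" where
  "alt_less a b \<longleftrightarrow> length a = length b \<and>
     (\<exists>j < length a. take j a = take j b \<and> (if even j then a ! j < b ! j else b ! j < a ! j))"

definition alt_le :: "'a::linorder list \<Rightarrow> 'a list \<Rightarrow> bool" where
  "alt_le a b \<longleftrightarrow> alt_less a b \<or> a = b"

definition alt_less_inf :: "'a::linorder stream \<Rightarrow> 'a stream \<Rightarrow> bool" where
  "alt_less_inf a b \<longleftrightarrow>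
     (\<exists>j. stake j a = stake j b \<and> (if even j then a !! j < b !! j else b !! j < a !! j))"

definition alt_le_inf :: "'a::linorder stream \<Rightarrow> 'a stream \<Rightarrow> bool" where
  "alt_le_inf a b \<longleftrightarrow> alt_less_inf a b \<or> a = b"

text \<open>For \<open>a\<close> of length \<open>2 * l + 1\<close>, \<open>drop (m - 1) a\<close> is $a_{[m,2\ell+1]}$ and
  \<open>take m a\<close> is $a_{[1,m]}$.\<close>

definition F :: "letter list set" where
  "F = {v \<in> lists A_minus.
          \<exists>l. length (char_seq v) = 2 * l + 1 \<and>
              (\<forall>j\<in>{1..l}.
                 alt_less (drop (2 * j - 1) (char_seq v)) (take (2 * l - 2 * j + 2) (char_seq v)) \<and>
                 alt_le (drop (2 * j) (char_seq v)) (take (2 * l - 2 * j + 1) (char_seq v)))}"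

definition gold :: real where
  "gold = (sqrt 5 - 1) / 2"

definition zeta :: "letter list \<Rightarrow> real" where
  "zeta v = cf (cycle (v @ hat v)) + 1"

definition eta :: "letter list \<Rightarrow> real" where
  "eta v = (if v = [] then 1 else cf (cycle (shift_last 1 v)) + 1)"

definition Gam_word :: "letter list \<Rightarrow> real set" where
  "Gam_word v = (if v = [] then {gold<..1} else {zeta v<..<eta v})"

end

theory Submission
  imports Defs
begin

text \<open>The characteristic sequence of \<open>\<alpha> - 1\<close> is the sequence of regular continued fraction
  quotients of \<open>\<alpha>\<close>, and everything translates to the Gauss map \<open>G y = frac (1 / y)\<close>: the complement
  of \<open>Gam\<close> is the set of \<open>\<alpha>\<close> with \<open>G\<^sup>n \<alpha> \<ge> \<alpha>\<close> for all \<open>n\<close>, since the even iterates of \<open>G\<close> control the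
  \<open>T \<alpha>\<close>-orbit of \<open>\<alpha> - 1\<close> and the odd ones that of \<open>\<alpha>\<close>.

  If some iterate falls below \<open>\<alpha>\<close>, cut the quotients of \<open>\<alpha>\<close> at the first such index and, if the
  length is even, pass to the odd-length expansion of the same rational number. Minimality of the
  index says that this list dominates its tails in the alternating order, so it comes from some
  \<open>v \<in> F\<close>, and the inequality at the cut says \<open>\<alpha> \<in> Gam_word v\<close>. Conversely, the odd and the even
  expansions of the rational number attached to \<open>v\<close> have periodic continuations \<open>zeta v\<close> and
  \<open>eta v\<close>; the tail inequalities needed for (ii) hold at these endpoints by the definition of \<open>F\<close>,
  and inside the interval because continued fraction branches are monotone contractions. Words
  \<open>v\<close>, \<open>w\<close> in \<open>F\<close> whose intervals meet are comparable prefixes, and the sign of the letter after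
  the shorter one forces \<open>v = w\<close>.

  Outside \<open>Gam\<close> the quotients are bounded by the first one. A set \<open>E\<close> with \<open>G ` E \<subseteq> E\<close> and quotients
  at most \<open>K\<close> is null: its mass for the invariant density \<open>1 / (1 + y)\<close> is at most the mass of the first
  \<open>K\<close> branches, which telescopes to the same mass minus the integral of \<open>1 / (K + 1 + y)\<close> over \<open>E\<close>.\<close>

section \<open>Continued fractions and the alternating order\<close>

definition gauss :: "real \<Rightarrow> real" where
  "gauss y = frac (1 / y)"

definition quot :: "real \<Rightarrow> nat" where
  "quot y = nat \<lfloor>1 / y\<rfloor>"

definition quots :: "nat \<Rightarrow> real \<Rightarrow> nat list" where
  "quots n y = map (\<lambda>i. quot ((gauss ^^ i) y)) [0..<n]"

text \<open>\<open>rcf a t\<close> is the inverse branch of the iterated Gauss map with digits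
  \<open>a\<close>, that is [0; a_1, ..., a_n + t]. Tails are allowed down to -1 (exclusive),
  because matching produces negative ones.\<close>

fun rcf :: "nat list \<Rightarrow> real \<Rightarrow> real" where
  "rcf [] t = t"
| "rcf (a # as) t = 1 / (real a + rcf as t)"

abbreviation pos_quots :: "nat list \<Rightarrow> bool" where
  "pos_quots a \<equiv> \<forall>x\<in>set a. 1 \<le> x"

lemma rcf_append: "rcf (a @ b) t = rcf a (rcf b t)"
  by (induction a) auto

lemma rcf_pos:
  assumes "pos_quots a" "a \<noteq> []" "- 1 < t"
  shows "0 < rcf a t"
  using assms
proof (induction a)
  case (Cons x a)
  have "- 1 < rcf a t"
  proof (cases "a = []")
    case False
    with Cons have "0 < rcf a t" by simp
    then show ?thesis by linarith
  qed (use Cons.prems in auto)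
  then show ?case using Cons.prems by simp
qed simp

lemma rcf_gt_minus_one:
  assumes "pos_quots a" "- 1 < t"
  shows "- 1 < rcf a t"
proof (cases "a = []")
  case False
  then show ?thesis using rcf_pos[OF assms(1) False assms(2)] by linarith
qed (use assms in simp)

lemma rcf_nonneg:
  assumes "pos_quots a" "0 \<le> t"
  shows "0 \<le> rcf a t"
proof (cases "a = []")
  case False
  then show ?thesis using rcf_pos[OF assms(1) False, of t] assms(2) by linarith
qed (use assms in simp)

lemma rcf_le_one:
  assumes "pos_quots a" "a \<noteq> []" "0 \<le> t"
  shows "rcf a t \<le> 1"
  using assms rcf_nonneg[of "tl a" t] by (cases a) auto

lemma rcf_less_one:
  assumes "pos_quots a" "a \<noteq> []" "0 < t"
  shows "rcf a t < 1"
proof -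
  obtain x b where a: "a = x # b" using assms(2) by (cases a) auto
  have "0 < rcf b t"
    using assms rcf_pos[of b t] a by (cases "b = []") auto
  then show ?thesis using a assms(1) by (simp add: a)
qed

text \<open>Every level \<open>1 / (x + _)\<close> reverses the order, so the parity of the number
  of levels decides; a tail above -1 keeps all denominators positive.\<close>

lemma rcf_mono:
  assumes "pos_quots a" "- 1 < s" "s < t"
  shows "if even (length a) then rcf a s < rcf a t else rcf a t < rcf a s"
  using assms(1)
proof (induction a)
  case (Cons x a)
  have "- 1 < rcf a s" "- 1 < rcf a t" "1 \<le> real x"
    using Cons.prems assms by (auto intro!: rcf_gt_minus_one)
  with Cons show ?case
    by (auto intro!: divide_strict_left_mono mult_pos_pos split: if_splits)
qed (use assms in auto)

lemma rcf_less_iff: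
  assumes "pos_quots a" "- 1 < s" "- 1 < t"
  shows "rcf a s < rcf a t \<longleftrightarrow> (if even (length a) then s < t else t < s)"
  using rcf_mono[OF assms(1,2), of t] rcf_mono[OF assms(1,3), of s]
  by (cases s t rule: linorder_cases) (auto split: if_splits)

lemma rcf_neq:
  assumes "pos_quots a" "- 1 < s" "- 1 < t" "s \<noteq> t"
  shows "rcf a s \<noteq> rcf a t"
  using rcf_less_iff[OF assms(1-3)] rcf_less_iff[OF assms(1,3,2)] assms(4)
  by (cases "s < t"; cases "even (length a)") simp_all

text \<open>The difference equals \<open>(t - s) / ((x + s) * (x + t))\<close>, and this denominator
  exceeds 1 since \<open>s\<close> and \<open>t\<close> are not both 0.\<close>

lemma inverse_diff_less:
  fixes s t :: real
  assumes "1 \<le> x" "0 \<le> s" "0 \<le> t" "s \<noteq> t"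
  shows "\<bar>1 / (x + s) - 1 / (x + t)\<bar> < \<bar>s - t\<bar>"
proof -
  have "1 / (x + s) - 1 / (x + t) = (t - s) / ((x + s) * (x + t))"
    using assms by (simp add: field_simps)
  moreover have "1 < (x + s) * (x + t)"
  proof (cases "s = 0")
    case True
    then have "1 < x + t" using assms by auto
    also have "\<dots> \<le> (x + s) * (x + t)"
      using mult_right_mono[of 1 "x + s" "x + t"] assms by simp
    finally show ?thesis .
  next
    case False
    then have "1 < x + s" using assms by auto
    also have "\<dots> \<le> (x + s) * (x + t)"
      using mult_left_mono[of 1 "x + t" "x + s"] assms by simp
    finally show ?thesis .
  qed
  ultimately show ?thesis
    using assms(4) by (simp add: abs_minus_commute divide_less_eq)
qed

text \<open>Iterates \<open>inverse_diff_less\<close>. Its strictness is what later makes fixed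
  points of branches unique and comparable with other points.\<close>

lemma rcf_contraction:
  assumes "pos_quots a" "0 \<le> s" "0 \<le> t" "s \<noteq> t" "a \<noteq> []"
  shows "\<bar>rcf a s - rcf a t\<bar> < \<bar>s - t\<bar>"
  using assms(1,5)
proof (induction a)
  case (Cons x a)
  have "pos_quots a" using Cons.prems by simp
  then have "rcf a s \<noteq> rcf a t" "0 \<le> rcf a s" "0 \<le> rcf a t"
    using rcf_neq[of a s t] rcf_nonneg[of a] assms by auto
  then have *: "\<bar>rcf (x # a) s - rcf (x # a) t\<bar> < \<bar>rcf a s - rcf a t\<bar>"
    using inverse_diff_less[of x "rcf a s" "rcf a t"] Cons.prems by simp
  show ?case
  proof (cases "a = []")
    case False
    with * Cons show ?thesis by simp
  qed (use * in simp)
qed simp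

lemma rcf_contraction_le:
  assumes "pos_quots a" "0 \<le> s" "0 \<le> t"
  shows "\<bar>rcf a s - rcf a t\<bar> \<le> \<bar>s - t\<bar>"
  using rcf_contraction[OF assms] by (cases "s = t"; cases "a = []") auto

text \<open>A single digit has no uniform rate, as the slope of \<open>1 / (1 + s)\<close> tends to
  -1 at 0; two consecutive digits always gain a factor 4.\<close>

lemma rcf_contraction_quarter:
  assumes "pos_quots a" "0 \<le> s" "0 \<le> t"
  shows "\<bar>rcf a s - rcf a t\<bar> \<le> (1/4) ^ (length a div 2) * \<bar>s - t\<bar>"
  using assms(1)
\<comment> \<open>The induction rule of \<open>word_of\<close> peels off two digits at a
  time.\<close>
proof (induction a rule: word_of.induct)
  case (3 x y a)
  define p q where "p = y + rcf a s" and "q = y + rcf a t"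
  have pq: "1 \<le> p" "1 \<le> q" "1 \<le> real x"
    using 3 rcf_nonneg[of a s] rcf_nonneg[of a t] assms by (auto simp: p_def q_def)
  have "rcf (x # y # a) s - rcf (x # y # a) t = 1 / (x + 1 / p) - 1 / (x + 1 / q)"
    by (simp add: p_def q_def)
  also have "\<dots> = (p - q) / ((x * p + 1) * (x * q + 1))"
  proof -
    have "1 / (x + 1 / p) = p / (x * p + 1)" "1 / (x + 1 / q) = q / (x * q + 1)"
      using pq by (simp_all add: field_simps)
    moreover have "x * p + 1 > 0" "x * q + 1 > 0"
      using pq by (simp_all add: add_nonneg_pos)
    ultimately show ?thesis by (simp add: diff_frac_eq) (simp add: algebra_simps)
  qed
  finally have "\<bar>rcf (x # y # a) s - rcf (x # y # a) t\<bar> = \<bar>p - q\<bar> / \<bar>(x * p + 1) * (x * q + 1)\<bar>"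
    by (simp add: abs_mult)
  also have "\<dots> \<le> \<bar>p - q\<bar> / 4"
  proof (rule divide_left_mono)
    have "1 \<le> x * p" "1 \<le> x * q"
      using pq mult_mono[of 1 "real x" 1 p] mult_mono[of 1 "real x" 1 q] by auto
    then have "2 * 2 \<le> (x * p + 1) * (x * q + 1)" by (intro mult_mono) auto
    then show "4 \<le> \<bar>(x * p + 1) * (x * q + 1)\<bar>" "0 < \<bar>(x * p + 1) * (x * q + 1)\<bar> * 4"
      by auto
  qed auto
  also have "\<dots> \<le> (1/4) ^ (length a div 2) * \<bar>s - t\<bar> / 4"
    using 3 by (simp add: p_def q_def)
  finally show ?case by simp
next
  case (2 x)
  then show ?case using rcf_contraction_le[of "[x]" s t] assms by simp
qed simp

lemma continuous_on_rcf:
  assumes "pos_quots a"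
  shows "continuous_on {-1<..} (rcf a)"
  using assms
proof (induction a)
  case Nil
  have "rcf [] = (\<lambda>t. t)" by auto
  then show ?case by (simp add: continuous_on_id)
next
  case (Cons x a)
  have "\<And>t. t \<in> {-1<..} \<Longrightarrow> real x + rcf a t \<noteq> 0"
    using Cons.prems rcf_gt_minus_one[of a] by force
  with Cons show ?case by (auto intro!: continuous_intros)
qed

section \<open>Gauss orbits and their quotient lists\<close>

lemma gauss_bounds: "0 \<le> gauss y" "gauss y < 1"
  by (auto simp: gauss_def frac_lt_1)

lemma funpow_gauss_bounds:
  assumes "0 < y" "y < 1"
  shows "0 \<le> (gauss ^^ n) y" "(gauss ^^ n) y < 1"
  using assms gauss_bounds by (cases n; simp; fail)+

lemma quot_pos:
  assumes "0 < y" "y \<le> 1"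
  shows "1 \<le> quot y"
  using assms by (simp add: quot_def le_nat_iff le_floor_iff)

lemma gauss_step:
  assumes "0 < y"
  shows "y = 1 / (quot y + gauss y)"
proof -
  have "real (quot y) + gauss y = 1 / y"
    using assms by (simp add: quot_def gauss_def frac_def)
  then show ?thesis by simp
qed

lemma length_quots [simp]: "length (quots n y) = n"
  by (simp add: quots_def)

lemma quots_0 [simp]: "quots 0 y = []"
  by (simp add: quots_def)

lemma quots_Suc: "quots (Suc n) y = quot y # quots n (gauss y)"
  unfolding quots_def
  by (simp add: upt_conv_Cons map_Suc_upt[symmetric] funpow_swap1 del: upt_Suc)

lemma drop_quots: "drop k (quots n y) = quots (n - k) ((gauss ^^ k) y)"
  by (rule nth_equalityI) (simp_all add: quots_def funpow_add add.commute[of k])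

lemma take_quots: "k \<le> n \<Longrightarrow> take k (quots n y) = quots k y"
  by (rule nth_equalityI) (auto simp: quots_def)

text \<open>Positivity is asked only before time \<open>n\<close>, so the lemma also covers a
  rational point whose orbit reaches 0 exactly at time \<open>n\<close>.\<close>

lemma rcf_quots:
  assumes "\<And>i. i < n \<Longrightarrow> 0 < (gauss ^^ i) y"
  shows "rcf (quots n y) ((gauss ^^ n) y) = y"
  using assms
proof (induction n arbitrary: y)
  case (Suc n)
  have "rcf (quots n (gauss y)) ((gauss ^^ n) (gauss y)) = gauss y"
    by (rule Suc.IH) (use Suc.prems[of "Suc _"] in \<open>simp add: funpow_swap1\<close>)
  then show ?case
    using gauss_step[of y] Suc.prems[of 0] by (simp add: quots_Suc funpow_swap1)
qed simp

lemma pos_quots_quots: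
  assumes "0 < y" "y < 1" "\<And>i. i < n \<Longrightarrow> 0 < (gauss ^^ i) y"
  shows "pos_quots (quots n y)"
proof
  fix x assume "x \<in> set (quots n y)"
  then obtain i where "i < n" "x = quot ((gauss ^^ i) y)" by (auto simp: quots_def)
  then show "1 \<le> x"
    using assms(3)[of i] funpow_gauss_bounds(2)[OF assms(1,2), of i] quot_pos by simp
qed

section \<open>The alternating order and the order of continued fraction values\<close>

lemma alt_less_Nil [simp]: "\<not> alt_less [] b" "\<not> alt_less a []"
  by (auto simp: alt_less_def)

text \<open>Removing a common first entry flips the parity of all later positions, hence the swapped
  arguments.\<close>

lemma alt_less_Cons:
  "alt_less (x # a) (y # b) \<longleftrightarrow> length a = length b \<and> (x < y \<or> x = y \<and> alt_less b a)"
proof -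
  have *: "(if even (Suc j) then a ! j < b ! j else b ! j < a ! j) \<longleftrightarrow>
      (if even j then b ! j < a ! j else a ! j < b ! j)" for j
    by simp
  show ?thesis
    unfolding alt_less_def length_Cons Ex_less_Suc2 take_Suc_Cons nth_Cons_Suc *
    by auto
qed

lemma alt_less_append:
  assumes "length a = length b" "length c = length d"
  shows "alt_less (a @ c) (b @ d) \<longleftrightarrow>
     alt_less a b \<or> a = b \<and> (if even (length a) then alt_less c d else alt_less d c)"
proof -
  \<comment> \<open>Both directions go through one induction, since \<open>alt_less_Cons\<close>
    swaps the arguments.\<close>
  have "(alt_less (a @ c) (b @ d) \<longleftrightarrow>
     alt_less a b \<or> a = b \<and> (if even (length a) then alt_less c d else alt_less d c)) \<and>
    (alt_less (b @ d) (a @ c) \<longleftrightarrow>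
     alt_less b a \<or> a = b \<and> (if even (length a) then alt_less d c else alt_less c d))"
    using assms(1)
    by (induction rule: list_induct2) (use assms(2) in \<open>auto simp: alt_less_Cons\<close>)
  then show ?thesis by blast
qed

lemma alt_less_linear:
  assumes "length a = length b"
  shows "alt_less a b \<or> a = b \<or> alt_less b a"
  using assms by (induction rule: list_induct2) (auto simp: alt_less_Cons)

lemma alt_less_irrefl [simp]: "\<not> alt_less a a"
  by (auto simp: alt_less_def)

lemma alt_le_hd:
  assumes "alt_le a b" "a \<noteq> []"
  shows "hd a \<le> hd b"
  using assms by (cases a; cases b) (auto simp: alt_le_def alt_less_Cons)

text \<open>A larger first digit gives a smaller value, and each level reverses the comparison of
  what follows; the alternating order is built to mirror this. The tails may differ, as they cannot
  outweigh a difference of digits.\<close>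

lemma rcf_alt_less:
  assumes "alt_less a b" "pos_quots a" "pos_quots b" "s \<in> {0..<1}" "t \<in> {0..<1}"
  shows "rcf b t < rcf a s"
proof -
  have "length a = length b" using assms(1) by (simp add: alt_less_def)
  then have "pos_quots a \<Longrightarrow> pos_quots b \<Longrightarrow>
    (alt_less a b \<longrightarrow> rcf b t < rcf a s) \<and> (alt_less b a \<longrightarrow> rcf a s < rcf b t)"
  proof (induction rule: list_induct2)
    case (Cons x a y b)
    have *: "0 \<le> rcf a s" "0 \<le> rcf b t"
      using assms(4,5) Cons.prems by (auto intro!: rcf_nonneg)
    have le: "rcf a s \<le> 1" "rcf b t \<le> 1"
      using assms(4,5) Cons.prems rcf_le_one[of a s] rcf_le_one[of b t]
      by (cases "a = []"; force)+
    \<comment> \<open>The remainders differ by less than 1: a remainder equals 1 only for a nonempty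
      list, and then the other one is positive.\<close>
    have eq: "rcf a s < 1 + rcf b t" "rcf b t < 1 + rcf a s"
      using le * Cons.hyps assms(4,5) Cons.prems rcf_pos[of a s] rcf_pos[of b t]
      by (cases "a = []"; cases "b = []"; force)+
    have lt: "x + rcf a s < y + rcf b t" if "x < y" 
      using that eq by linarith
    have gt: "y + rcf b t < x + rcf a s" if "y < x" 
      using that eq by linarith
    have pos: "0 < x + rcf a s" "0 < y + rcf b t"
      using * Cons.prems by auto
    have less: "rcf (y # b) t < rcf (x # a) s \<longleftrightarrow> x + rcf a s < y + rcf b t"
      "rcf (x # a) s < rcf (y # b) t \<longleftrightarrow> y + rcf b t < x + rcf a s"
      using pos by (simp_all add: field_simps)
    show ?case
      unfolding less alt_less_Cons using Cons.IH Cons.prems lt gt by auto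
  qed simp
  with assms show ?thesis by blast
qed

section \<open>Orbits and by-excess words\<close>

text \<open>Recording both the letters emitted and the point reached makes orbit segments
  composable.\<close>

definition follows :: "real \<Rightarrow> real \<Rightarrow> letter list \<Rightarrow> real \<Rightarrow> bool" where
  "follows \<beta> x w z \<longleftrightarrow>
     expansion \<beta> x = w @- expansion \<beta> z \<and> (T \<beta> ^^ length w) x = z"

lemma expansion_unfold: "expansion \<beta> x = letter_at \<beta> x ## expansion \<beta> (T \<beta> x)"
  unfolding expansion_def by (subst siterate.code) simp

lemma expansion_snth: "expansion \<beta> x !! n = letter_at \<beta> ((T \<beta> ^^ n) x)"
  unfolding expansion_def by simp

lemma follows_Nil [simp]: "follows \<beta> x [] z \<longleftrightarrow> x = z"
  by (auto simp: follows_def)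

lemma follows_append:
  assumes "follows \<beta> x v y" "follows \<beta> y w z"
  shows "follows \<beta> x (v @ w) z"
  using assms by (simp add: follows_def funpow_add add.commute[of "length v"])

lemma follows_Cons:
  assumes "follows \<beta> x [a] y" "follows \<beta> y w z"
  shows "follows \<beta> x (a # w) z"
  using follows_append[OF assms] by simp

text \<open>\<open>d\<close> is the floor in the definition of \<open>T\<close>: only one integer
  leaves a remainder in a half-open interval of length one.\<close>

lemma follows_pos:
  assumes "z \<in> {\<beta> - 1..<\<beta>}" "0 < x" "x = 1 / (of_int d + z)"
  shows "follows \<beta> x [Dig 1 d] z"
proof -
  have eq: "\<bar>1 / x\<bar> = of_int d + z"
    using assms by (simp add: abs_if)
  then have "0 < of_int d + z"
    unfolding eq[symmetric] using assms(2) by simp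
  moreover from eq have f: "\<lfloor>\<bar>1 / x\<bar> + 1 - \<beta>\<rfloor> = d"
    using assms(1) by (intro floor_unique) auto
  ultimately have "letter_at \<beta> x = Dig 1 d" "T \<beta> x = z"
    using assms(2) unfolding letter_at_def T_def f eq by auto
  then show ?thesis
    unfolding follows_def by (subst expansion_unfold) simp
qed

lemma follows_neg:
  assumes "z \<in> {\<beta> - 1..<\<beta>}" "x < 0" "x = - 1 / (of_int d + z)"
  shows "follows \<beta> x [Dig (-1) d] z"
proof -
  have eq: "\<bar>1 / x\<bar> = of_int d + z"
    using assms by (simp add: abs_if)
  then have "0 < of_int d + z"
    unfolding eq[symmetric] using assms(2) by simp
  moreover from eq have f: "\<lfloor>\<bar>1 / x\<bar> + 1 - \<beta>\<rfloor> = d"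
    using assms(1) by (intro floor_unique) auto
  ultimately have "letter_at \<beta> x = Dig (-1) d" "T \<beta> x = z"
    using assms(2) unfolding letter_at_def T_def f eq by auto
  then show ?thesis
    unfolding follows_def by (subst expansion_unfold) simp
qed

text \<open>With u = j + s the identity 1/(u + 1) - 1 = -1/(2 + (1/u - 1)) shows that the letter
  \<open>(-1:2)\<close> lowers \<open>j\<close> by one.\<close>

lemma follows_twos:
  assumes "0 < s" "\<beta> \<le> 1 / (real j + s)" "1 / s - 1 < \<beta>"
  shows "follows \<beta> (1 / (real j + s) - 1) (replicate j (Dig (-1) 2)) (1 / s - 1)"
  using assms(2)
proof (induction j)
  case (Suc j)
  \<comment> \<open>The points increase along the run, so a lower bound at its start and an upper
    bound at its end confine all of them.\<close>
  have "1 / (real (Suc j) + s) \<le> 1 / (real j + s)" "1 / (real j + s) \<le> 1 / s"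
    using assms(1) by (auto intro!: divide_left_mono mult_pos_pos)
  then have z: "1 / (real j + s) - 1 \<in> {\<beta> - 1..<\<beta>}" "\<beta> \<le> 1 / (real j + s)"
    using Suc.prems assms(3) by auto
  have "1 / (real (Suc j) + s) - 1 < 0"
    using assms(1) by simp
  moreover have "1 / (real (Suc j) + s) - 1 = - 1 / (of_int 2 + (1 / (real j + s) - 1))"
    using assms(1) by (simp add: field_simps)
  ultimately have "follows \<beta> (1 / (real (Suc j) + s) - 1) [Dig (-1) 2] (1 / (real j + s) - 1)"
    by (intro follows_neg z)
  then show ?case
    using Suc.IH[OF z(2)] by (auto intro: follows_Cons)
qed simp

text \<open>Two consecutive regular quotients correspond to one run of twos closed by one larger
  letter; this is the passage from the regular to the by-excess expansion.\<close>

lemma follows_block: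
  assumes "1 \<le> a" "z \<in> {\<beta> - 1..<\<beta>}" "0 < of_int d - 1 + z" "0 \<le> \<beta>"
    and "\<beta> \<le> 1 / (real a + 1 / (of_int d - 1 + z))"
  shows "follows \<beta> (1 / (real a + 1 / (of_int d - 1 + z)) - 1)
           (replicate (a - 1) (Dig (-1) 2) @ [Dig (-1) d]) z"
proof -
  \<comment> \<open>For q = d - 1 + z this choice gives 1/s - 1 = -1/(1 + q) = -1/(d + z), the point
    that emits the closing letter.\<close>
  define s where "s = 1 + 1 / (of_int d - 1 + z)"
  have s: "real a + 1 / (of_int d - 1 + z) = real (a - 1) + s" "0 < s"
    using assms by (simp_all add: s_def of_nat_diff add_pos_pos)
  have eq: "1 / s - 1 = - 1 / (of_int d + z)"
    using assms(3) by (simp add: s_def field_simps)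
  have "1 / s - 1 < 0"
    unfolding eq using assms(3) by simp
  then have "follows \<beta> (1 / s - 1) [Dig (-1) d] z"
    by (intro follows_neg assms eq)
  moreover have "1 / s - 1 < \<beta>"
    using \<open>1 / s - 1 < 0\<close> assms(4) by linarith
  then have "follows \<beta> (1 / (real (a - 1) + s) - 1) (replicate (a - 1) (Dig (-1) 2)) (1 / s - 1)"
    using assms(5) s by (intro follows_twos) auto
  ultimately show ?thesis
    unfolding s by (rule follows_append[rotated])
qed

lemma rcf_less_one_add:
  assumes "pos_quots a" "even (length a)" "0 \<le> y" "y < 1 + \<beta>" "0 \<le> \<beta>"
  shows "rcf a y < 1 + \<beta>"
proof (cases a rule: word_of.cases)
  case (3 x z b)
  have "0 < rcf (z # b) y"
    using assms 3 rcf_nonneg[of b y] by simp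
  moreover have "1 \<le> real x" using 3 assms by simp
  ultimately have "1 < real x + rcf (z # b) y" by linarith
  then have "rcf a y < 1"
    unfolding 3 rcf.simps(2)[of x] by (simp only: divide_less_eq_1) simp
  then show ?thesis using assms by simp
qed (use assms in auto)

text \<open>Each pair of quotients emits one block, so the blocks start at tails with even index,
  shifted by -1. Only these tails need the lower bound \<beta>; inside a block
  \<open>follows_block\<close> takes over, and the upper bound follows from
  \<open>rcf_less_one_add\<close>.\<close>

lemma follows_word_of:
  assumes "even (length a)" "pos_quots a" "y - 1 \<in> {\<beta> - 1..<\<beta>}" "0 \<le> \<beta>"
    and "\<And>i. even i \<Longrightarrow> i < length a \<Longrightarrow> \<beta> \<le> rcf (drop i a) y"
  shows "follows \<beta> (rcf a y - 1) (word_of a) (y - 1)"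
  using assms(1,2,5)
proof (induction a rule: word_of.induct)
  case (3 a b c)
  have c: "even (length c)" "pos_quots c" "1 \<le> a" "1 \<le> b"
    using "3.prems" by auto
  have IH: "follows \<beta> (rcf c y - 1) (word_of c) (y - 1)"
    using "3.prems"(3)[of "Suc (Suc _)"] c by (intro "3.IH") auto
  have "\<beta> \<le> rcf c y"
  proof (cases "c = []")
    case False
    then show ?thesis using "3.prems"(3)[of 2] by (simp add: numeral_2_eq_2)
  qed (use assms(3) in auto)
  moreover have "rcf c y < 1 + \<beta>"
    using c assms(3,4) by (intro rcf_less_one_add) auto
  ultimately have "follows \<beta> (1 / (real a + 1 / (of_int (2 + int b) - 1 + (rcf c y - 1))) - 1)
           (replicate (a - 1) (Dig (-1) 2) @ [Dig (-1) (2 + int b)]) (rcf c y - 1)"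
    using c assms(4) "3.prems"(3)[of 0] by (intro follows_block) (auto simp: algebra_simps)
  then have "follows \<beta> (rcf (a # b # c) y - 1)
           (replicate (a - 1) (Dig (-1) 2) @ [Dig (-1) (2 + int b)]) (rcf c y - 1)"
    by (simp add: algebra_simps)
  from follows_append[OF this IH] show ?case by simp
qed auto

text \<open>\<open>\<bar>1 / z\<bar>\<close> and \<open>\<bar>1 / x\<bar>\<close> differ by exactly
  1, which changes the digit by one and leaves the image under \<open>T \<alpha>\<close> unchanged.
  This is how the two orbits merge.\<close>

lemma T_conjugate:
  assumes "- 1 < x" "z = - x / (1 + x)"
  shows "letter_at \<alpha> z = W (letter_at \<alpha> x)" "T \<alpha> z = T \<alpha> x"
proof -
  have "letter_at \<alpha> z = W (letter_at \<alpha> x) \<and> T \<alpha> z = T \<alpha> x"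
  proof (cases x "0::real" rule: linorder_cases)
    case less
    then have z: "0 < z" using assms by (simp add: divide_neg_pos)
    have "1 / z = - (1 / x) - 1"
      unfolding assms(2) using assms(1) less by (simp add: field_simps)
    moreover have "0 < 1 / z" "1 / x < 0" using z less by auto
    ultimately have eq: "\<bar>1 / z\<bar> = \<bar>1 / x\<bar> - 1"
      by linarith
    have "\<bar>1 / z\<bar> + 1 - \<alpha> = (\<bar>1 / x\<bar> + 1 - \<alpha>) - 1"
      unfolding eq by simp
    then have "\<lfloor>\<bar>1 / z\<bar> + 1 - \<alpha>\<rfloor> = \<lfloor>\<bar>1 / x\<bar> + 1 - \<alpha>\<rfloor> - 1"
      by (simp only: floor_diff_one)
    then show ?thesis
      using less z unfolding letter_at_def T_def eq by simp
  next
    case equal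
    with assms show ?thesis by (simp add: letter_at_def T_def)
  next
    case greater
    then have z: "z < 0" using assms by (simp add: divide_neg_pos)
    have "1 / z = - (1 / x) - 1"
      unfolding assms(2) using assms(1) greater by (simp add: field_simps)
    moreover have "1 / z < 0" "0 < 1 / x" using z greater by auto
    ultimately have eq: "\<bar>1 / z\<bar> = \<bar>1 / x\<bar> + 1"
      by linarith
    have "\<bar>1 / z\<bar> + 1 - \<alpha> = (\<bar>1 / x\<bar> + 1 - \<alpha>) + 1"
      unfolding eq by simp
    then have "\<lfloor>\<bar>1 / z\<bar> + 1 - \<alpha>\<rfloor> = \<lfloor>\<bar>1 / x\<bar> + 1 - \<alpha>\<rfloor> + 1"
      by (simp only: one_add_floor)
    then show ?thesis
      using greater z unfolding letter_at_def T_def eq by simp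
  qed
  then show "letter_at \<alpha> z = W (letter_at \<alpha> x)" "T \<alpha> z = T \<alpha> x" by auto
qed

section \<open>Finite words and their characteristic sequences\<close>

lemma word_of_append: "even (length a) \<Longrightarrow> word_of (a @ b) = word_of a @ word_of b"
proof (induction a rule: word_of.induct)
  case (3 x y a)
  then show ?case by (cases "a @ b") auto
qed auto

text \<open>The hat exchanges the roles of odd and even positions; once the first entry has become a
  letter, the remaining entries are read as in \<open>word_of\<close>.\<close>

lemma hat_word_of_Cons:
  "even (length b) \<Longrightarrow> hat_word_of (x # b) = Dig (-1) (2 + int x) # word_of b"
  by (induction b arbitrary: x rule: word_of.induct) auto

lemma word_of_in_A_minus: "word_of a \<in> lists A_minus"
  by (induction a rule: word_of.induct) (auto simp: A_minus_def)

text \<open>As q and q' are positive, the closing letters are not \<open>(-1:2)\<close>, so the ends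
  of the two runs are visible in the word.\<close>

lemma twos_prefix_eqD:
  assumes "replicate p (Dig (-1) 2) @ Dig (-1) (2 + int q) # v
         = replicate p' (Dig (-1) 2) @ Dig (-1) (2 + int q') # v'" "1 \<le> q" "1 \<le> q'"
  shows "p = p' \<and> q = q' \<and> v = v'"
  using assms(1)
proof (induction p arbitrary: p')
  case 0
  then show ?case using assms(2,3) by (cases p') auto
next
  case (Suc p)
  then show ?case using assms(2,3) by (cases p') auto
qed

text \<open>Lengths of equal parity are required: \<open>word_of [] = word_of [1]\<close>.\<close>

lemma word_of_inj:
  assumes "pos_quots a" "pos_quots b" "even (length a) = even (length b)" "word_of a = word_of b"
  shows "a = b"
  using assms
proof (induction a arbitrary: b rule: word_of.induct)
  case 1
  then show ?case by (cases b rule: word_of.cases) auto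
next
  case (2 x)
  then show ?case
  proof (cases b rule: word_of.cases)
    case (3 c d e)
    have "Dig (-1) (2 + int d) \<in> set (word_of [x])"
      unfolding 2 3 by simp
    then show ?thesis using 2 3 by auto
  qed auto
next
  case (3 x y a)
  then show ?case
  proof (cases b rule: word_of.cases)
    case (2 c)
    have "Dig (-1) (2 + int y) \<in> set (word_of [c])"
      unfolding 2[symmetric] 3(5)[symmetric] by simp
    then show ?thesis using 2 3 by auto
  next
    case b: (3 c d e)
    have *: "x - 1 = c - 1 \<and> y = d \<and> word_of a = word_of e"
      using 3(5) 3(2,3) unfolding b by (intro twos_prefix_eqD) auto
    have "a = e"
      by (rule "3.IH") (use "3.prems" b * in simp_all)
    moreover have "1 \<le> x" "1 \<le> c" using "3.prems" b by simp_all
    ultimately have "x = c" using * by linarith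
    with \<open>a = e\<close> * b show ?thesis by simp
  qed auto
qed

text \<open>Prepending \<open>(-1:2)\<close> raises the first entry by one; prepending
  \<open>(-1:d)\<close> with d > 2 prepends the entries 1 and d - 2.\<close>

lemma ex_word_of:
  assumes "v \<in> lists A_minus"
  shows "\<exists>a. is_char_seq v a"
  using assms
proof (induction v)
  case Nil
  have "is_char_seq [] [1]" by (simp add: is_char_seq_def)
  then show ?case by blast
next
  case (Cons x v)
  then obtain a where a: "odd (length a)" "pos_quots a" "v = word_of a" and "x \<in> A_minus"
    by (auto simp: is_char_seq_def)
  then obtain d where d: "x = Dig (-1) d" "2 \<le> d" by (auto simp: A_minus_def)
  show ?case
  proof (cases "d = 2")
    case True
    obtain y b where y: "a = y # b" "1 \<le> y" using a by (cases a) auto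
    have "word_of (Suc y # b) = Dig (-1) 2 # word_of (y # b)"
      using y by (cases b) (auto simp flip: replicate_Suc append_Cons simp: Suc_diff_le)
    then have "is_char_seq (x # v) (Suc y # b)"
      using a d y True by (auto simp: is_char_seq_def)
    then show ?thesis by blast
  next
    case False
    then have "is_char_seq (x # v) (1 # nat (d - 2) # a)"
      using a d by (auto simp: is_char_seq_def)
    then show ?thesis by blast
  qed
qed

lemma char_seq_eq:
  assumes "is_char_seq v a"
  shows "char_seq v = a"
  unfolding char_seq_def
  using assms by (intro the_equality) (auto simp: is_char_seq_def intro: word_of_inj)

lemma char_seq_works: "v \<in> lists A_minus \<Longrightarrow> is_char_seq v (char_seq v)"
  using ex_word_of char_seq_eq by metis

fun excess :: "letter \<Rightarrow> nat" where
  "excess (Dig e d) = nat (d - 2)"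
| "excess Top = 0"

text \<open>A pair \<open>x, y\<close> of entries contributes \<open>y\<close> letters to the hat
  word, while in \<open>word_of\<close> its closing letter has excess \<open>y\<close> and twos have
  excess 0. Hence a prefix of a word has a hat that is no longer, which serves the disjointness
  proof.\<close>

lemma length_hat_word_of:
  assumes "odd (length a)" "pos_quots a"
  shows "length (hat_word_of a) = Suc (sum_list (map excess (word_of a)))"
  using assms
  by (induction a rule: word_of.induct) (auto simp: sum_list_replicate)

lemma hat_word_of_inj:
  assumes "odd (length a)" "odd (length b)" "pos_quots a" "pos_quots b" "hat_word_of a = hat_word_of b"
  shows "a = b"
proof -
  obtain x c y d where "a = x # c" "b = y # d"
    using assms(1,2) by (cases a; cases b) auto
  then show ?thesis
    using assms word_of_inj[of c d] by (auto simp: hat_word_of_Cons)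
qed

section \<open>The endpoints of the matching intervals\<close>

text \<open>The bracket [[w, x]]: \<open>cf_fin\<close> with a real tail in place of the final
  0.\<close>

fun cfx :: "letter list \<Rightarrow> real \<Rightarrow> real" where
  "cfx [] x = x"
| "cfx (Dig e d # w) x = of_int e / (of_int d + cfx w x)"
| "cfx (Top # w) x = 0"

lemma cf_fin_eq_cfx: "cf_fin w = cfx w 0"
  by (induction w rule: cf_fin.induct) auto

lemma cfx_append: "cfx (v @ w) x = cfx v (cfx w x)"
  by (induction v x rule: cfx.induct) auto

lemma cfx_bounds:
  assumes "w \<in> lists A_minus" "x \<in> {-1..0}"
  shows "cfx w x \<in> {-1..0}"
  using assms(1)
proof (induction w)
  case (Cons l w)
  then obtain d where "l = Dig (-1) d" "2 \<le> d" by (auto simp: A_minus_def)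
  moreover from this have "2 \<le> real_of_int d" by simp
  ultimately show ?case using Cons.IH Cons.prems by (simp add: divide_le_eq)
qed (use assms in simp)

lemma cfx_mono:
  assumes "w \<in> lists A_minus" "x \<in> {-1..0}" "y \<in> {-1..0}" "x \<le> y"
  shows "cfx w x \<le> cfx w y"
  using assms(1)
proof (induction w)
  case (Cons l w)
  then obtain d where d: "l = Dig (-1) d" "2 \<le> d" "w \<in> lists A_minus"
    by (auto simp: A_minus_def)
  then have "2 \<le> real_of_int d" by simp
  with d Cons.IH cfx_bounds[OF d(3) assms(2)] cfx_bounds[OF d(3) assms(3)]
  show ?case by (simp add: frac_le)
qed (use assms in simp)

lemma continuous_on_cfx:
  assumes "w \<in> lists A_minus"
  shows "continuous_on {-1..0} (cfx w)"
  using assms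
proof (induction w)
  case Nil
  have "cfx [] = (\<lambda>x. x)" by auto
  then show ?case by (simp add: continuous_on_id)
next
  case (Cons l w)
  then obtain d where d: "l = Dig (-1) d" "2 \<le> d" "w \<in> lists A_minus"
    by (auto simp: A_minus_def)
  have "of_int d + cfx w x \<noteq> 0" if "x \<in> {-1..0}" for x
  proof -
    have "2 \<le> real_of_int d" using d(2) by simp
    then show ?thesis using cfx_bounds[OF d(3) that] by auto
  qed
  then have "continuous_on {-1..0} (\<lambda>x. of_int (-1) / (of_int d + cfx w x))"
    using Cons.IH d(3) by (intro continuous_intros) auto
  moreover have "cfx (l # w) = (\<lambda>x. of_int (-1) / (of_int d + cfx w x))"
    using d(1) by auto
  ultimately show ?case by simp
qed

text \<open>Appending a letter replaces the tail 0 by a nonpositive one, so the convergents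
  decrease; they are bounded below by -1 and converge. Continuity of \<open>cfx u\<close> turns
  periodicity into the fixed point equation.\<close>

lemma cf_cycle:
  assumes "u \<in> lists A_minus" "u \<noteq> []"
  shows "cf (cycle u) \<in> {-1..0}" "cfx u (cf (cycle u)) = cf (cycle u)"
proof -
  define X where "X n = cf_fin (stake n (cycle u))" for n
  have lists: "stake n (cycle u) \<in> lists A_minus" for n
  proof -
    have "sset (cycle u) \<subseteq> A_minus" using assms by (auto simp: sset_cycle)
    then have "cycle u !! i \<in> A_minus" for i
      using snth_sset by blast
    then show ?thesis
      by (auto simp: in_set_conv_nth)
  qed
  have X: "X n \<in> {-1..0}" for n
    unfolding X_def cf_fin_eq_cfx by (intro cfx_bounds lists) simp
  have "decseq X"
  proof (rule decseq_SucI)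
    fix n
    have "cycle u !! n \<in> A_minus"
      using lists[of "Suc n"] by (simp only: stake_Suc) simp
    then have "cfx [cycle u !! n] 0 \<in> {-1..0}"
      by (intro cfx_bounds) auto
    then show "X (Suc n) \<le> X n"
      unfolding X_def cf_fin_eq_cfx stake_Suc cfx_append
      by (intro cfx_mono lists) auto
  qed
  moreover have "\<forall>i. - 1 \<le> X i" using X by auto
  ultimately obtain L where L: "X \<longlonglongrightarrow> L"
    using decseq_convergent by blast
  then have cf: "cf (cycle u) = L"
    unfolding cf_def X_def by (rule limI)
  have "L \<in> {-1..0}"
    by (rule closed_sequentially[OF _ _ L]) (use X in auto)
  then show "cf (cycle u) \<in> {-1..0}" by (simp add: cf)
  have "X (n + length u) = cfx u (X n)" for n
  proof -
    have "stake (length u + n) (cycle u) = u @ stake n (cycle u)"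
      by (subst cycle_decomp[OF assms(2)]) (simp add: stake_shift)
    then show ?thesis
      unfolding X_def cf_fin_eq_cfx by (simp add: add.commute cfx_append)
  qed
  then have "(\<lambda>n. cfx u (X n)) \<longlonglongrightarrow> L"
    using LIMSEQ_ignore_initial_segment[OF L, of "length u"] by simp
  moreover have "(\<lambda>n. cfx u (X n)) \<longlonglongrightarrow> cfx u L"
    by (rule continuous_on_tendsto_compose[OF continuous_on_cfx[OF assms(1)] L])
       (use X \<open>L \<in> _\<close> in auto)
  ultimately show "cfx u (cf (cycle u)) = cf (cycle u)"
    unfolding cf by (metis LIMSEQ_unique)
qed

lemma cfx_twos:
  assumes "0 < s"
  shows "cfx (replicate j (Dig (-1) 2)) (1 / s - 1) = 1 / (real j + s) - 1"
proof (induction j)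
  case (Suc j)
  have "cfx (replicate (Suc j) (Dig (-1) 2)) (1 / s - 1) = of_int (- 1) / (of_int 2 + (1 / (real j + s) - 1))"
    by (simp only: replicate_Suc cfx.simps Suc)
  also have "\<dots> = 1 / (real (Suc j) + s) - 1"
    using assms by (simp add: field_simps)
  finally show ?case .
qed simp

lemma cfx_word_of_even:
  assumes "even (length a)" "pos_quots a" "0 \<le> y"
  shows "cfx (word_of a) (y - 1) = rcf a y - 1"
  using assms(1,2)
proof (induction a rule: word_of.induct)
  case (3 a b c)
  define q where "q = real b + rcf c y"
  have q: "0 < q" using "3.prems" rcf_nonneg[of c y] assms(3) by (simp add: q_def add_pos_nonneg)
  have IH: "cfx (word_of c) (y - 1) = rcf c y - 1"
    using "3.prems" by (intro "3.IH") auto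
  have "cfx (Dig (-1) (2 + int b) # word_of c) (y - 1) = of_int (- 1) / (of_int (2 + int b) + (rcf c y - 1))"
    by (simp only: cfx.simps IH)
  also have "\<dots> = - 1 / (1 + q)"
    by (simp add: q_def algebra_simps)
  also have "\<dots> = 1 / (1 + 1 / q) - 1"
    using q by (simp add: field_simps)
  finally have "cfx (word_of (a # b # c)) (y - 1) = 1 / (real (a - 1) + (1 + 1 / q)) - 1"
    unfolding word_of.simps cfx_append using q by (simp only:) (intro cfx_twos, simp add: add_pos_pos)
  then show ?case
    using "3.prems" by (simp add: q_def of_nat_diff)
qed auto

lemma odd_snocE:
  assumes "odd (length a)"
  obtains c k where "a = c @ [k]" "even (length c)"
  using assms by (cases a rule: rev_cases) auto

text \<open>The last entry k yields only k - 1 twos. A regular tail \<open>t\<close> therefore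
  becomes the by-excess tail 1/(1 + t) - 1 = -t/(1 + t), the conjugation of
  \<open>T_conjugate\<close>.\<close>

lemma cfx_word_of_odd:
  assumes "odd (length a)" "pos_quots a" "- 1 < t"
  shows "cfx (word_of a) (1 / (1 + t) - 1) = rcf a t - 1"
proof -
  obtain c k where a: "a = c @ [k]" "even (length c)" using odd_snocE assms(1) by blast
  have k: "1 \<le> k" using assms(2) a by auto
  have "cfx (word_of [k]) (1 / (1 + t) - 1) = 1 / (real k + t) - 1"
    using cfx_twos[of "1 + t" "k - 1"] k assms(3) by (simp add: of_nat_diff)
  moreover have "0 \<le> 1 / (real k + t)"
    using k assms(3) by simp
  ultimately show ?thesis
    using cfx_word_of_even[OF a(2), of "1 / (real k + t)"] assms(2)
    by (simp add: a word_of_append cfx_append rcf_append)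
qed

text \<open>The last run of twos of \<open>word_of b\<close> is closed by the first letter of the
  hat. In particular v followed by its hat encodes \<open>a @ a\<close>, so the period of
  \<open>zeta\<close> is the regular period \<open>a\<close>.\<close>

lemma word_of_hat:
  assumes "odd (length b)" "odd (length a)" "pos_quots b"
  shows "word_of b @ hat_word_of a = word_of (b @ a)"
  using assms
proof (induction b rule: word_of.induct)
  case (2 x)
  then obtain y c where "a = y # c" "even (length c)" by (cases a) auto
  then show ?case by (simp add: hat_word_of_Cons)
next
  case (3 x y b)
  then show ?case by (cases "b @ a") auto
qed auto

lemma cfx_shift_last:
  assumes "v \<noteq> []"
  shows "cfx (shift_last k v) x = cfx v (x + of_int k)"
proof -
  obtain w l where "v = w @ [l]" using assms by (cases v rule: rev_cases) auto
  then show ?thesis by (cases l) (auto simp: shift_last_def cfx_append algebra_simps)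
qed

section \<open>The endpoints as fixed points of regular branches\<close>

lemma word_of_eq_Nil:
  assumes "pos_quots a" "odd (length a)"
  shows "word_of a = [] \<longleftrightarrow> a = [1]"
  using assms by (cases a rule: word_of.cases) auto

lemma hat_word_of:
  assumes "pos_quots a" "odd (length a)"
  shows "char_seq (word_of a) = a" "hat (word_of a) = hat_word_of a"
  using char_seq_eq[of "word_of a" a] assms by (auto simp: hat_def is_char_seq_def)

lemma zeta_fixpoint:
  assumes "pos_quots a" "odd (length a)"
  shows "zeta (word_of a) \<in> {0..1}" "rcf a (zeta (word_of a)) = zeta (word_of a)"
proof -
  define y where "y = zeta (word_of a)"
  define x where "x = cf (cycle (word_of (a @ a)))"
  have xy: "y = 1 + x"
    unfolding y_def x_def zeta_def hat_word_of(2)[OF assms] word_of_hat[OF assms(2,2,1)] by simp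
  have "word_of (a @ a) \<noteq> []"
    using length_hat_word_of[OF assms(2,1)] word_of_hat[OF assms(2,2,1)] by force
  from cf_cycle[OF word_of_in_A_minus this]
  have x: "x \<in> {-1..0}" "cfx (word_of (a @ a)) x = x" by (simp_all add: x_def)
  then have y: "y \<in> {0..1}" "rcf (a @ a) y = y"
    using cfx_word_of_even[of "a @ a" y] assms by (auto simp: xy)
  then show "zeta (word_of a) \<in> {0..1}" by (simp add: y_def)
  \<comment> \<open>So far \<open>y\<close> is only fixed by the square of \<open>rcf a\<close>. If
    \<open>rcf a y\<close> were different, \<open>rcf a\<close> would exchange the two points and
    keep their distance, against strict contraction.\<close>
  have "rcf a (rcf a y) = y" using y by (simp add: rcf_append)
  moreover have "a \<noteq> []" using assms(2) by auto
  ultimately have "rcf a y = y"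
    using rcf_contraction[OF assms(1), of "rcf a y" y] rcf_nonneg[OF assms(1), of y] y(1) assms(2)
    by (auto simp: abs_minus_commute)
  then show "rcf a (zeta (word_of a)) = zeta (word_of a)" by (simp add: y_def)
qed

text \<open>Raising the last digit by one moves the by-excess tail from x to x + 1 = h, and this
  corresponds to the regular tail -h/(1 + h).\<close>

lemma eta_fixpoint:
  assumes "pos_quots a" "odd (length a)" "a \<noteq> [1]"
  defines "h \<equiv> eta (word_of a)"
  shows "h \<in> {0..1}" "rcf a (- h / (1 + h)) = h"
proof -
  define v where "v = word_of a"
  have v: "v \<noteq> []" "v \<in> lists A_minus"
    using word_of_eq_Nil[OF assms(1,2)] assms(3) word_of_in_A_minus by (simp_all add: v_def)
  have "shift_digit 1 (last v) \<in> A_minus"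
    using last_in_set[OF v(1)] v(2) by (auto simp: A_minus_def)
  then have s: "shift_last 1 v \<in> lists A_minus" "shift_last 1 v \<noteq> []"
    using v by (auto simp: shift_last_def dest: in_set_butlastD)
  define x where "x = cf (cycle (shift_last 1 v))"
  have xh: "x = h - 1" using v(1) by (simp add: x_def h_def eta_def v_def)
  have x: "x \<in> {-1..0}" "cfx v (x + 1) = x"
    using cf_cycle[OF s] cfx_shift_last[OF v(1), of 1 x] by (simp_all add: x_def)
  then show h: "h \<in> {0..1}" by (simp add: xh)
  have "1 / (1 + - h / (1 + h)) - 1 = h"
    using h by (simp add: field_simps)
  moreover have "- 1 < - h / (1 + h)"
    using h by (simp add: field_simps)
  ultimately show "rcf a (- h / (1 + h)) = h"
    using cfx_word_of_odd[OF assms(2,1), of "- h / (1 + h)"] x(2) by (simp add: v_def xh)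
qed

text \<open>The odd-length and the even-length expansion of the same rational number.\<close>

inductive twin :: "nat list \<Rightarrow> nat list \<Rightarrow> bool" where
  "1 \<le> k \<Longrightarrow> twin (c @ [Suc k]) (c @ [k, 1])"
| "1 \<le> k \<Longrightarrow> twin (c @ [k, 1]) (c @ [Suc k])"

text \<open>Since (k + 1) - y/(1 + y) = k + 1/(1 + y), the twins agree at tail 0, and a tail
  \<open>y\<close> of one is a tail -y/(1 + y) of the other.\<close>

lemma rcf_twin:
  assumes "twin a e" "0 \<le> y"
  shows "rcf a (- y / (1 + y)) = rcf e y"
  using assms(1)
proof cases
  case (1 k c)
  have "real (Suc k) + - y / (1 + y) = real k + 1 / (1 + y)"
    using assms(2) by (simp add: field_simps)
  from this[symmetric] show ?thesis unfolding 1 rcf_append rcf.simps by (simp only: of_nat_1)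
next
  case (2 k c)
  have "real 1 + - y / (1 + y) = 1 / (1 + y)"
    using assms(2) by (simp add: field_simps)
  then have eq: "real k + 1 / (real 1 + - y / (1 + y)) = real (Suc k) + y"
    by (simp only:) simp
  show ?thesis unfolding 2 rcf_append rcf.simps eq ..
qed

lemma twin_sym: "twin a e \<Longrightarrow> twin e a"
  by (auto simp: twin.simps)

lemma twin_even: "twin a e \<Longrightarrow> even (length e) \<longleftrightarrow> odd (length a)"
  by (auto simp: twin.simps)

lemma twin_pos_quots: "twin a e \<Longrightarrow> pos_quots a \<longleftrightarrow> pos_quots e"
  by (auto simp: twin.simps)

lemma twin_ne: "twin a e \<Longrightarrow> a \<noteq> [1] \<and> e \<noteq> [1] \<and> a \<noteq> [] \<and> e \<noteq> []"
  by (auto simp: twin.simps)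

lemma ex_twin:
  assumes "pos_quots a" "a \<noteq> [1]" "a \<noteq> []"
  shows "\<exists>e. twin a e"
proof -
  obtain b k where a: "a = b @ [k]" "1 \<le> k" using assms by (cases a rule: rev_cases) auto
  show ?thesis
  proof (cases "k = 1")
    case True
    then obtain c m where "b = c @ [m]" "1 \<le> m"
      using assms a by (cases b rule: rev_cases) auto
    then show ?thesis using a True twin.intros(2)[of m c] by auto
  next
    case False
    then obtain j where "k = Suc j" "1 \<le> j" using a(2) by (cases k) auto
    then show ?thesis using a twin.intros(1)[of j b] by auto
  qed
qed

text \<open>A branch of odd length is decreasing, so it crosses the diagonal downwards at its fixed
  point.\<close>

lemma zeta_less_iff:
  assumes "pos_quots a" "odd (length a)" "\<alpha> \<in> {0..1}"
  shows "zeta (word_of a) < \<alpha> \<longleftrightarrow> rcf a \<alpha> < \<alpha>"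
proof -
  let ?z = "zeta (word_of a)"
  note z = zeta_fixpoint[OF assms(1,2)]
  show ?thesis
    using rcf_less_iff[OF assms(1), of \<alpha> ?z] rcf_less_iff[OF assms(1), of ?z \<alpha>] z assms(2,3)
    by auto
qed

text \<open>The twin branch \<open>rcf e\<close> has even length and is increasing, as is the
  diagonal; strict contraction towards its fixed point \<open>eta\<close> decides on which side of
  \<alpha> the value lies.\<close>

lemma less_eta_iff:
  assumes "pos_quots a" "odd (length a)" "a \<noteq> [1]" "\<alpha> \<in> {0..1}"
  shows "\<alpha> < eta (word_of a) \<longleftrightarrow> \<alpha> < rcf a (- \<alpha> / (1 + \<alpha>))"
proof -
  let ?h = "eta (word_of a)"
  note h = eta_fixpoint[OF assms(1-3)]
  have "a \<noteq> []" using assms(2) by auto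
  then obtain e where e: "twin a e" using ex_twin[OF assms(1,3)] by blast
  have eq: "rcf a (- \<alpha> / (1 + \<alpha>)) = rcf e \<alpha>"
    by (rule rcf_twin[OF e]) (use assms(4) in simp)
  have "rcf a (- ?h / (1 + ?h)) = rcf e ?h"
    by (rule rcf_twin[OF e]) (use h(1) in simp)
  with h(2) have h2: "rcf e ?h = ?h" by simp
  have "\<bar>rcf e \<alpha> - rcf e ?h\<bar> < \<bar>\<alpha> - ?h\<bar>" if "\<alpha> \<noteq> ?h"
    by (rule rcf_contraction) (use that h(1) assms(1,4) twin_pos_quots[OF e] twin_ne[OF e] in simp_all)
  then show ?thesis unfolding eq h2 by (cases "\<alpha> = ?h") (simp_all add: h2, linarith)
qed

text \<open>The two endpoint inequalities place \<alpha> strictly between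
  \<open>rcf a \<alpha>\<close> and \<open>rcf a (- \<alpha> / (1 + \<alpha>))\<close>, and the
  intermediate value theorem gives the tail \<open>t\<close> that remains after the quotients
  \<open>a\<close>.\<close>

lemma Gam_word_iff:
  assumes "pos_quots a" "odd (length a)" "a \<noteq> [1]"
  shows "\<alpha> \<in> Gam_word (word_of a) \<longleftrightarrow>
    0 < \<alpha> \<and> \<alpha> < 1 \<and> (\<exists>t. - \<alpha> / (1 + \<alpha>) < t \<and> t < \<alpha> \<and> rcf a t = \<alpha>)"
    (is "?lhs \<longleftrightarrow> ?rhs")
proof -
  have "word_of a \<noteq> []" using word_of_eq_Nil assms by simp
  then have lhs: "?lhs \<longleftrightarrow> zeta (word_of a) < \<alpha> \<and> \<alpha> < eta (word_of a)"
    by (auto simp: Gam_word_def)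
  have bounds: "0 < \<alpha> \<and> \<alpha> < 1" if ?lhs
    using that zeta_fixpoint[OF assms(1,2)] eta_fixpoint[OF assms] by (auto simp: lhs)
  have iff: "?lhs \<longleftrightarrow> rcf a \<alpha> < \<alpha> \<and> \<alpha> < rcf a (- \<alpha> / (1 + \<alpha>))" if "0 < \<alpha> \<and> \<alpha> < 1"
    using that zeta_less_iff[OF assms(1,2)] less_eta_iff[OF assms] by (auto simp: lhs)
  have low: "- 1 < - \<alpha> / (1 + \<alpha>)" "- \<alpha> / (1 + \<alpha>) < \<alpha>" if "0 < \<alpha> \<and> \<alpha> < 1"
  proof -
    have "0 < \<alpha> / (1 + \<alpha>)" "\<alpha> / (1 + \<alpha>) < 1" using that by simp_all
    moreover have "- \<alpha> / (1 + \<alpha>) = - (\<alpha> / (1 + \<alpha>))" by simp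
    ultimately show "- 1 < - \<alpha> / (1 + \<alpha>)" "- \<alpha> / (1 + \<alpha>) < \<alpha>" using that by linarith+
  qed
  show ?thesis
  proof
    assume l: ?lhs
    note b = bounds[OF l]
    have "continuous_on {- \<alpha> / (1 + \<alpha>)..\<alpha>} (rcf a)"
      using low[OF b] by (intro continuous_on_subset[OF continuous_on_rcf[OF assms(1)]]) auto
    then obtain t where t: "- \<alpha> / (1 + \<alpha>) \<le> t" "t \<le> \<alpha>" "rcf a t = \<alpha>"
      using IVT2'[of "rcf a" \<alpha> \<alpha> "- \<alpha> / (1 + \<alpha>)"] iff[OF b] l low[OF b] by auto
    moreover have "t \<noteq> \<alpha>" "- \<alpha> / (1 + \<alpha>) \<noteq> t"
      using iff[OF b] l t(3) by auto
    ultimately have "- \<alpha> / (1 + \<alpha>) < t" "t < \<alpha>" by (simp_all add: less_le)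
    then show ?rhs using b t(3) by blast
  next
    assume r: ?rhs
    then obtain t where t: "- \<alpha> / (1 + \<alpha>) < t" "t < \<alpha>" "rcf a t = \<alpha>" by blast
    have b: "0 < \<alpha> \<and> \<alpha> < 1" using r by blast
    have "rcf a \<alpha> < rcf a t" "rcf a t < rcf a (- \<alpha> / (1 + \<alpha>))"
      using rcf_less_iff[OF assms(1), of \<alpha> t] rcf_less_iff[OF assms(1), of t "- \<alpha> / (1 + \<alpha>)"]
        low[OF b] t assms(2) b by auto
    then show ?lhs using iff[OF b] t by simp
  qed
qed

section \<open>Matching\<close>

text \<open>In a list of odd length the tails at even positions (counted from 1) have even length,
  so strictness by parity covers both clauses of \<open>F\<close>. Phrased through the tail length,
  the condition also makes sense for lists of even length and passes to twins.\<close>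

definition dominated :: "nat list \<Rightarrow> nat list \<Rightarrow> bool" where
  "dominated s p \<longleftrightarrow> (if even (length s) then alt_less s p else alt_le s p)"

definition admissible :: "nat list \<Rightarrow> bool" where
  "admissible a \<longleftrightarrow> (\<forall>i. 0 < i \<and> i < length a \<longrightarrow> dominated (drop i a) (take (length a - i) a))"

lemma admissibleD:
  assumes "admissible a" "0 < i" "i < length a"
  shows "alt_le (drop i a) (take (length a - i) a)"
    and "even (length a - i) \<Longrightarrow> alt_less (drop i a) (take (length a - i) a)"
  using assms by (auto simp: admissible_def dominated_def alt_le_def split: if_splits)

text \<open>For integers, \<open>Suc k \<le> p\<close> is \<open>k < p\<close> and
  \<open>p < Suc k\<close> is \<open>p \<le> k\<close>; in the second case a tie is settled by
  comparing 1 with q, which holds weakly. The parity change swaps strict and weak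
  accordingly.\<close>

lemma dominated_twin:
  assumes "length X = length Y" "1 \<le> q"
  shows "dominated (X @ [Suc k]) (Y @ [p]) \<longleftrightarrow> dominated (X @ [k, 1]) (Y @ [p, q])"
proof -
  have 1: "alt_less (X @ [Suc k]) (Y @ [p]) \<longleftrightarrow>
      alt_less X Y \<or> X = Y \<and> (if even (length X) then Suc k < p else p < Suc k)"
    using assms(1) alt_less_append[of X Y "[Suc k]" "[p]"] by (simp add: alt_less_Cons)
  have 2: "alt_less (X @ [k, 1]) (Y @ [p, q]) \<longleftrightarrow>
      alt_less X Y \<or> X = Y \<and> (if even (length X) then k < p else p < k \<or> p = k \<and> 1 < q)"
    using assms alt_less_append[of X Y "[k, 1]" "[p, q]"] by (auto simp: alt_less_Cons)
  show ?thesis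
    using assms unfolding dominated_def alt_le_def 1 2 by auto
qed

lemma admissible_twin:
  assumes "pos_quots c" "1 \<le> k"
  shows "admissible (c @ [Suc k]) \<longleftrightarrow> admissible (c @ [k, 1])"
proof -
  have step: "dominated (drop i (c @ [Suc k])) (take (length (c @ [Suc k]) - i) (c @ [Suc k])) \<longleftrightarrow>
      dominated (drop i (c @ [k, 1])) (take (length (c @ [k, 1]) - i) (c @ [k, 1]))"
    if i: "0 < i" "i \<le> length c" for i
  proof -
    define n where "n = length c - i"
    have n: "n < length c" using i by (simp add: n_def)
    have "take (Suc n) (c @ d) = take n c @ [c ! n]" for d
      using n by (simp add: take_Suc_conv_app_nth)
    moreover from this have "take (Suc (Suc n)) (c @ [k, 1]) = take n c @ [c ! n, (c @ [k, 1]) ! Suc n]"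
      using n take_Suc_conv_app_nth[of "Suc n" "c @ [k, 1]"] by simp
    moreover have "length (c @ [Suc k]) - i = Suc n" "length (c @ [k, 1]) - i = Suc (Suc n)"
      using i by (auto simp: n_def)
    moreover have "drop i (c @ [Suc k]) = drop i c @ [Suc k]" "drop i (c @ [k, 1]) = drop i c @ [k, 1]"
      using i by simp_all
    moreover have "1 \<le> (c @ [k, 1]) ! Suc n"
      using assms n nth_mem[of "Suc n" "c @ [k, 1]"] by force
    moreover have "length (drop i c) = length (take n c)" by (simp add: n_def)
    ultimately show ?thesis
      using dominated_twin[of "drop i c" "take n c"] by simp
  qed
  \<comment> \<open>The longer list has one additional tail, \<open>[1]\<close>, which is dominated
    because the first digit is at least 1.\<close>
  have last: "dominated (drop (Suc (length c)) (c @ [k, 1])) (take (Suc 0) (c @ [k, 1]))"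
    using assms by (cases c) (auto simp: dominated_def alt_le_def alt_less_Cons)
  show ?thesis
  proof
    assume L: "admissible (c @ [Suc k])"
    show "admissible (c @ [k, 1])"
      unfolding admissible_def
    proof (intro allI impI)
      fix i assume i: "0 < i \<and> i < length (c @ [k, 1])"
      show "dominated (drop i (c @ [k, 1])) (take (length (c @ [k, 1]) - i) (c @ [k, 1]))"
      proof (cases "i \<le> length c")
        case True
        then show ?thesis using L[unfolded admissible_def, rule_format, of i] i step[of i] by auto
      next
        case False
        then have "i = Suc (length c)" using i by auto
        then show ?thesis using last by simp
      qed
    qed
  next
    assume R: "admissible (c @ [k, 1])"
    show "admissible (c @ [Suc k])"
      unfolding admissible_def
    proof (intro allI impI)
      fix i assume i: "0 < i \<and> i < length (c @ [Suc k])"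
      then show "dominated (drop i (c @ [Suc k])) (take (length (c @ [Suc k]) - i) (c @ [Suc k]))"
        using R[unfolded admissible_def, rule_format, of i] step[of i] by auto
    qed
  qed
qed

lemma twin_admissible:
  assumes "twin a e" "pos_quots a"
  shows "admissible a \<longleftrightarrow> admissible e"
  using assms(1)
proof cases
  case (1 k c)
  then show ?thesis using assms(2) admissible_twin[of c k] by simp
next
  case (2 k c)
  then show ?thesis using assms(2) admissible_twin[of c k] by simp
qed

text \<open>If the first digit were 1, domination would force all digits to be 1; the tail without
  the first digit, nonempty and of even length, would then equal its prefix, against
  strictness.\<close>

lemma admissible_hd:
  assumes "pos_quots a" "odd (length a)" "a \<noteq> [1]" "admissible a"
  shows "2 \<le> hd a"
proof (rule ccontr)
  assume "\<not> 2 \<le> hd a"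
  moreover have ne: "a \<noteq> []" using assms(2) by auto
  then have "1 \<le> hd a" using assms(1) by simp
  ultimately have hd: "hd a = 1" by simp
  have one: "a ! i = 1" if "i < length a" for i
  proof (cases "i = 0")
    case True
    then show ?thesis using hd ne by (simp add: hd_conv_nth)
  next
    case False
    then have "hd (drop i a) \<le> hd (take (length a - i) a)"
      using that by (intro alt_le_hd admissibleD(1)[OF assms(4)]) auto
    then have "a ! i \<le> 1"
      using that hd by (simp add: hd_drop_conv_nth)
    moreover have "1 \<le> a ! i" using assms(1) that nth_mem by blast
    ultimately show ?thesis by simp
  qed
  have len: "1 < length a"
  proof (rule ccontr)
    assume "\<not> ?thesis"
    then have "a = [a ! 0]" using ne by (cases a) auto
    then show False using one[of 0] ne assms(3) by simp
  qed
  have "drop 1 a = take (length a - 1) a"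
    by (rule nth_equalityI) (use one in auto)
  moreover have "alt_less (drop 1 a) (take (length a - 1) a)"
    using len assms(2) by (intro admissibleD(2)[OF assms(4)]) auto
  ultimately show False by simp
qed

section \<open>Tails of periodic expansions at the endpoints\<close>

lemma pos_quots_take_drop:
  assumes "pos_quots a"
  shows "pos_quots (take i a)" "pos_quots (drop i a)"
  using assms by (auto dest: in_set_takeD in_set_dropD)

lemma fixpoint_bounds:
  assumes "pos_quots a" "a \<noteq> []" "0 \<le> z" "rcf a z = z"
  shows "0 < z" "z < 1"
proof -
  show "0 < z" using rcf_pos[OF assms(1,2), of z] assms(3,4) by simp
  from rcf_less_one[OF assms(1,2) this] show "z < 1" using assms(4) by simp
qed

lemma rcf_drop_bounds:
  assumes "pos_quots a" "0 < z" "z < 1"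
  shows "rcf (drop i a) z \<in> {0<..<1}"
proof (cases "drop i a = []")
  case True
  then show ?thesis unfolding True using assms by simp
next
  case False
  then show ?thesis
    using assms pos_quots_take_drop[of a i] by (simp add: rcf_pos rcf_less_one)
qed

lemma rcf_take_drop: "rcf (take i a) (rcf (drop i a) t) = rcf a t"
  by (simp flip: rcf_append)

lemma fixpoint_le_tail:
  assumes a: "pos_quots a" "odd (length a)" "admissible a" and z: "0 \<le> z" "rcf a z = z"
    and i: "even i" "i < length a"
  shows "z \<le> rcf (drop i a) z"
proof (cases "i = 0")
  case True
  then show ?thesis using z by simp
next
  case False
  define m where "m = length a - i"
  have m: "0 < m" "m < length a" "odd m" "length a - m = i"
    using False i a(2) by (auto simp: m_def)
  have ne: "a \<noteq> []" using i by auto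
  note z01 = fixpoint_bounds[OF a(1) ne z]
  note tails = rcf_drop_bounds[OF a(1) z01]
  note pos = pos_quots_take_drop[OF a(1)]
  have eq: "rcf (take j a) (rcf (drop j a) z) = z" for j
    using z by (simp add: rcf_take_drop)
  have less: "rcf p (rcf (drop j a) z) < rcf s z" if "alt_less s p" "pos_quots s" "pos_quots p" for s p j
    using that z01 tails[of j] by (intro rcf_alt_less) auto
  have "alt_le (drop i a) (take m a)"
    using admissibleD(1)[OF a(3), of i] False i by (simp add: m_def)
  then consider "alt_less (drop i a) (take m a)" | "drop i a = take m a"
    unfolding alt_le_def by blast
  then show ?thesis
  proof cases
    case 1
    from less[OF this pos(2,1), of m] show ?thesis unfolding eq by simp
  next
    case 2
    \<comment> \<open>Equality moves the comparison to the complementary index \<open>m\<close>. The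
      tail there has even length \<open>i\<close>, so domination is strict, and the decreasing
      branch \<open>rcf (take m a)\<close> brings the inequality back to index
      \<open>i\<close>.\<close>
    have "alt_less (drop m a) (take i a)"
      using admissibleD(2)[OF a(3) m(1,2)] i m by simp
    then have "z < rcf (drop m a) z"
      using less[of "drop m a" "take i a" i] eq[of i] pos by metis
    then have "rcf (take m a) (rcf (drop m a) z) < rcf (take m a) z"
      using rcf_less_iff[of "take m a" "rcf (drop m a) z" z] tails[of m] z01 m pos by simp
    then show ?thesis using eq[of m] 2 by simp
  qed
qed

text \<open>If the tail at \<open>i\<close> were below \<open>h\<close>, domination would be an equality of lists there, and
  contraction would make the tail at \<open>length e - i\<close> smaller still; applying this twice returns to \<open>i\<close>.\<close>

lemma even_fixpoint_le_tail:
  assumes e: "pos_quots e" "even (length e)" "admissible e" and h: "0 \<le> h" "rcf e h = h"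
    and i: "odd i" "i < length e"
  shows "h \<le> rcf (drop i e) h"
proof (rule ccontr)
  have ne: "e \<noteq> []" using i by auto
  note h01 = fixpoint_bounds[OF e(1) ne h]
  note tails = rcf_drop_bounds[OF e(1) h01]
  note pos = pos_quots_take_drop[OF e(1)]
  have smaller: "rcf (drop (length e - j) e) h < rcf (drop j e) h"
    if j: "odd j" "j < length e" and lt: "rcf (drop j e) h < h" for j
  proof -
    define m where "m = length e - j"
    have m: "0 < j" "m < length e" "odd m" "take m e \<noteq> []"
      using j e(2) by (auto simp: m_def elim: oddE)
    have eq: "rcf (take m e) (rcf (drop m e) h) = h"
      using h by (simp add: rcf_take_drop)
    have "\<not> alt_less (drop j e) (take m e)"
    proof
      assume "alt_less (drop j e) (take m e)"
      then have "rcf (take m e) (rcf (drop m e) h) < rcf (drop j e) h"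
        by (rule rcf_alt_less) (use pos h01 tails[of m] in auto)
      then show False using eq lt by simp
    qed
    then have same: "drop j e = take m e"
      using admissibleD(1)[OF e(3) m(1) j(2)] by (simp add: alt_le_def m_def)
    then have "rcf (take m e) h < rcf (take m e) (rcf (drop m e) h)"
      using eq lt by simp
    then have "rcf (drop m e) h < h"
      using rcf_less_iff[of "take m e" h "rcf (drop m e) h"] tails[of m] h01 m pos by simp
    moreover have "\<bar>rcf (take m e) h - rcf (take m e) (rcf (drop m e) h)\<bar> < \<bar>h - rcf (drop m e) h\<bar>"
      using calculation tails[of m] h01 pos m(4) by (intro rcf_contraction) auto
    ultimately show ?thesis
      using eq same lt unfolding m_def by simp
  qed
  assume "\<not> h \<le> rcf (drop i e) h"
  then have lt: "rcf (drop i e) h < h" by simp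
  note s1 = smaller[OF i lt]
  have "odd (length e - i)" "length e - i < length e"
    using i e(2) by (auto elim: oddE)
  then have "rcf (drop (length e - (length e - i)) e) h < rcf (drop (length e - i) e) h"
    by (rule smaller) (use s1 lt in linarith)
  then show False using s1 i by simp
qed

text \<open>Twins differ only in \<open>[Suc k]\<close> against \<open>[k, 1]\<close> at the end; as
  \<open>a\<close> has odd length, a cut at an odd index never separates \<open>k\<close> from
  1.\<close>

lemma twin_drop:
  assumes "twin a e" "odd (length a)" "odd i" "i < length a"
  shows "twin (drop i a) (drop i e)" "i < length e"
proof -
  have "twin (drop i a) (drop i e) \<and> i < length e"
    using assms(1)
  proof cases
    case (1 k c)
    then have "i \<le> length c" using assms by simp
    then show ?thesis using 1 twin.intros(1)[of k "drop i c"] by simp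
  next
    case (2 k c)
    then have "i \<noteq> Suc (length c)" using assms by auto
    then have "i \<le> length c" using assms 2 by simp
    then show ?thesis using 2 twin.intros(2)[of k "drop i c"] by simp
  qed
  then show "twin (drop i a) (drop i e)" "i < length e" by auto
qed

text \<open>Here \<open>t\<close> is the image of \<open>\<alpha>\<close> under \<open>T \<alpha>\<close> iterated \<open>length (hat (word_of a))\<close> times, and \<open>x\<close>, defined
  below, is the image of \<open>\<alpha> - 1\<close> after \<open>length (word_of a)\<close> steps.\<close>

locale matching =
  fixes a :: "nat list" and \<alpha> t :: real
  assumes a: "pos_quots a" "odd (length a)" "a \<noteq> [1]" "admissible a"
    and \<alpha>: "0 < \<alpha>" "\<alpha> < 1"
    and t: "- \<alpha> / (1 + \<alpha>) < t" "t < \<alpha>" "rcf a t = \<alpha>"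
begin

lemma t_bounds: "- 1 < t" "0 < 1 + t"
proof -
  have "\<alpha> / (1 + \<alpha>) < 1" using \<alpha> by simp
  moreover have "- \<alpha> / (1 + \<alpha>) = - (\<alpha> / (1 + \<alpha>))" by simp
  ultimately show "- 1 < t" using t(1) by linarith
  then show "0 < 1 + t" by simp
qed

text \<open>This is \<alpha> < g. The first digit is at least 2, so \<alpha> < 1/2 unless
  \<open>a\<close> is a single digit, where the lower bound on \<open>t\<close> is used.\<close>

lemma golden: "\<alpha> * (1 + \<alpha>) < 1"
proof -
  obtain x b where xb: "a = x # b" using a(2) by (cases a) auto
  have x: "2 \<le> x" using admissible_hd[OF a] xb by simp
  have alpha: "\<alpha> = 1 / (real x + rcf b t)" using t(3) xb by simp
  show ?thesis
  proof (cases "b = []")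
    case True
    have pos: "0 < real x + t" using x t_bounds by simp
    have "(1 - \<alpha> / (1 + \<alpha>)) < real x - 1 + t" using x t(1) by simp
    then have "1 / (1 + \<alpha>) < real x - 1 + t" using \<alpha> by (simp add: field_simps)
    then have "1 + 1 / (1 + \<alpha>) < 1 / \<alpha>" using alpha True by simp
    then have "\<alpha> * (1 + 1 / (1 + \<alpha>)) < 1" using \<alpha> by (simp add: field_simps)
    then have "\<alpha> * (2 + \<alpha>) < 1 + \<alpha>" using \<alpha> by (simp add: field_simps)
    then show ?thesis by (simp add: algebra_simps)
  next
    case False
    have "0 < rcf b t" using a(1) xb False t_bounds by (intro rcf_pos) auto
    then have "2 < 1 / \<alpha>" using alpha x by simp
    then have "2 * \<alpha> < 1" using \<alpha> by (simp add: field_simps)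
    then have "\<alpha> * (1 + \<alpha>) < \<alpha> * 2"
      using \<alpha> by (intro mult_strict_left_mono) auto
    then show ?thesis using \<open>2 * \<alpha> < 1\<close> by simp
  qed
qed

definition "x = 1 / (1 + t) - 1"

text \<open>The bound t > -\<alpha>/(1 + \<alpha>) is the same as x < \<alpha>, while t < \<alpha>
  and \<open>golden\<close> give 1 + t < 1/\<alpha>, that is x > \<alpha> - 1.\<close>

lemma x_bounds: "\<alpha> - 1 \<le> x" "x < \<alpha>" "- 1 < x" "t = - x / (1 + x)"
proof -
  have "1 - \<alpha> / (1 + \<alpha>) < 1 + t" using t(1) by simp
  then have "1 / (1 + \<alpha>) < 1 + t" using \<alpha> by (simp add: field_simps)
  then have "1 / (1 + t) < 1 + \<alpha>" using \<alpha> t_bounds by (simp add: field_simps)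
  then show "x < \<alpha>" by (simp add: x_def)
  have "\<alpha> * (1 + t) < \<alpha> * (1 + \<alpha>)" using \<alpha> t(2) by simp
  then have "\<alpha> < 1 / (1 + t)" using t_bounds golden by (simp add: field_simps)
  then show "\<alpha> - 1 \<le> x" by (simp add: x_def)
  show "- 1 < x" using t_bounds by (simp add: x_def)
  show "t = - x / (1 + x)" using t_bounds by (simp add: x_def field_simps)
qed

lemma t_ge: "\<alpha> - 1 \<le> t"
proof -
  have "(\<alpha> - 1) * (1 + \<alpha>) < - \<alpha>" using golden by (simp add: algebra_simps)
  then have "\<alpha> - 1 < - \<alpha> / (1 + \<alpha>)" using \<alpha> by (simp add: field_simps)
  then show ?thesis using t(1) by simp
qed

lemma in_interval: "zeta (word_of a) < \<alpha>" "\<alpha> < eta (word_of a)"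
proof -
  have "\<alpha> \<in> Gam_word (word_of a)"
    unfolding Gam_word_iff[OF a(1-3)] using \<alpha> t by blast
  moreover have "word_of a \<noteq> []" using word_of_eq_Nil a by simp
  ultimately show "zeta (word_of a) < \<alpha>" "\<alpha> < eta (word_of a)" by (auto simp: Gam_word_def)
qed

text \<open>Let A and Z be the tails at \<open>i\<close> with continuation \<open>t\<close> and
  \<open>z = zeta\<close>. As \<open>t < z\<close>, Z < A, and \<alpha> - z is at most A - Z because
  \<open>rcf (take i a)\<close> contracts. With z \<le> Z this gives \<alpha> \<le> A.\<close>

lemma even_tails:
  assumes i: "even i" "i < length a"
  shows "\<alpha> \<le> rcf (drop i a) t"
proof -
  define z where "z = zeta (word_of a)"
  have z: "0 \<le> z" "rcf a z = z" "z < \<alpha>"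
    using zeta_fixpoint[OF a(1,2)] in_interval by (auto simp: z_def)
  have "t < z"
    using rcf_less_iff[OF a(1), of z t] z t(3) t_bounds a(2) by simp
  define A where "A = rcf (drop i a) t"
  define Z where "Z = rcf (drop i a) z"
  have "Z < A"
    using rcf_less_iff[of "drop i a" z t] pos_quots_take_drop[OF a(1), of i] t_bounds z \<open>t < z\<close> i a(2)
    by (simp add: A_def Z_def)
  have "z \<le> Z"
    unfolding Z_def by (rule fixpoint_le_tail) (use a z i in auto)
  have "\<bar>rcf (take i a) A - rcf (take i a) Z\<bar> \<le> \<bar>A - Z\<bar>"
    using \<open>z \<le> Z\<close> \<open>Z < A\<close> z pos_quots_take_drop[OF a(1), of i] by (intro rcf_contraction_le) auto
  then have "\<alpha> - z \<le> A - Z"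
    using \<open>Z < A\<close> z(2) t(3) by (simp add: A_def Z_def rcf_take_drop)
  then show ?thesis using \<open>z \<le> Z\<close> by (simp add: A_def)
qed

text \<open>The remaining length is even, so the tail lies above the one with continuation -h/(1 +
  h), h = \<open>eta\<close>. By twinning, the latter is a tail of the even expansion at its fixed
  point h, hence at least h > \<alpha>.\<close>

lemma odd_tails:
  assumes i: "odd i" "i < length a"
  shows "\<alpha> \<le> rcf (drop i a) t"
proof -
  define h where "h = eta (word_of a)"
  have h: "0 \<le> h" "rcf a (- h / (1 + h)) = h" "\<alpha> < h"
    using eta_fixpoint[OF a(1-3)] in_interval by (auto simp: h_def)
  have "h / (1 + h) < 1" using h by simp
  then have h1: "- 1 < - h / (1 + h)" by simp
  then have "- h / (1 + h) < t"
    using rcf_less_iff[OF a(1), of t "- h / (1 + h)"] h t(3) t_bounds a(2) by simp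
  then have "rcf (drop i a) (- h / (1 + h)) < rcf (drop i a) t"
    using rcf_less_iff[of "drop i a" "- h / (1 + h)" t] pos_quots_take_drop[OF a(1), of i] t_bounds h1 i a(2)
    by simp
  moreover have "a \<noteq> []" using a(2) by auto
  then obtain e where e: "twin a e" using ex_twin[OF a(1,3)] by blast
  note d = twin_drop[OF e a(2) i]
  have "h \<le> rcf (drop i e) h"
  proof (rule even_fixpoint_le_tail)
    show "pos_quots e" "even (length e)" "admissible e"
      using twin_pos_quots[OF e] twin_even[OF e] twin_admissible[OF e] a by auto
    show "rcf e h = h" using rcf_twin[OF e h(1)] h(2) by simp
  qed (use h i d in auto)
  moreover have "rcf (drop i a) (- h / (1 + h)) = rcf (drop i e) h"
    by (rule rcf_twin[OF d(1) h(1)])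
  ultimately show ?thesis using h(3) by linarith
qed

lemma follows_lower: "follows \<alpha> (\<alpha> - 1) (word_of a) x"
proof -
  obtain c k where ck: "a = c @ [k]" "even (length c)" using odd_snocE a(2) by blast
  \<comment> \<open>\<open>Y - 1\<close> is the orbit point at which the blocks of \<open>c\<close>
    end and the last run of k - 1 twos begins.\<close>
  define Y where "Y = 1 / (real k + t)"
  have k: "1 \<le> k" "pos_quots c" using a(1) ck by auto
  have Y: "rcf (drop i c) Y = rcf (drop i a) t" if "i \<le> length c" for i
    using that ck by (simp add: Y_def rcf_append)
  have Ya: "\<alpha> \<le> Y" using even_tails[of "length c"] Y[of "length c"] ck by simp
  have "1 / (real k + t) \<le> 1 / (1 + t)"
    using k t_bounds by (intro divide_left_mono) auto
  then have Yb: "Y - 1 < \<alpha>" using x_bounds(2) by (simp add: Y_def x_def)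
  have "follows \<alpha> (rcf c Y - 1) (word_of c) (Y - 1)"
    using ck(2) k(2) Ya Yb \<alpha> Y even_tails ck(1) by (intro follows_word_of) auto
  moreover have "follows \<alpha> (1 / (real (k - 1) + (1 + t)) - 1) (replicate (k - 1) (Dig (-1) 2)) (1 / (1 + t) - 1)"
    using t_bounds Ya k x_bounds(2) by (intro follows_twos) (auto simp: Y_def x_def of_nat_diff)
  moreover have "real (k - 1) + (1 + t) = real k + t" using k by (simp add: of_nat_diff)
  ultimately have "follows \<alpha> (rcf c Y - 1) (word_of c @ replicate (k - 1) (Dig (-1) 2)) x"
    unfolding Y_def x_def by (auto intro: follows_append)
  then show ?thesis
    using Y[of 0] t(3) ck by (simp add: word_of_append)
qed

text \<open>The first quotient y emits \<open>(+1:y+1)\<close>; the remaining quotients pair up with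
  a shift by one, so the blocks start at odd tails.\<close>

lemma follows_upper: "follows \<alpha> \<alpha> (W_word (shift_last (-1) (hat_word_of a))) t"
proof (cases "length a = 1")
  case True
  then obtain k where k: "a = [k]" by (cases a) auto
  have "follows \<alpha> \<alpha> [Dig 1 (int k)] t"
    by (rule follows_pos) (use t t_ge \<alpha> k in auto)
  then show ?thesis by (simp add: k shift_last_def)
next
  case False
  then obtain y b where yb: "a = y # b" "b \<noteq> []" "even (length b)"
    using a(2) by (cases a) auto
  obtain b' k where b': "b = b' @ [k]" "odd (length b')"
    using yb(2,3) by (cases b rule: rev_cases) auto
  obtain c m where "b' = c @ [m]" "even (length c)" using odd_snocE b'(2) by blast
  then have b: "b = c @ [m, k]" "even (length c)" using b' by auto
  have pos: "1 \<le> y" "1 \<le> m" "1 \<le> k" "pos_quots c" using a(1) yb b by auto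
  define Y where "Y = 1 / (real m + 1 / (real k + t))"
  have kt: "0 < real k + t" using pos t_bounds by simp
  have Y: "rcf (drop i c) Y = rcf (drop (Suc i) a) t" if "i \<le> length c" for i
    using that yb b by (simp add: Y_def rcf_append)
  have Ya: "\<alpha> \<le> Y" using odd_tails[of "Suc (length c)"] Y[of "length c"] yb b by simp
  have "1 < real m + 1 / (real k + t)" 
  proof -
    have "0 < 1 / (real k + t)" "1 \<le> real m" using pos kt by simp_all
    then show ?thesis by linarith
  qed
  then have Y1: "Y < 1" by (simp add: Y_def)
  define X where "X = rcf c Y"
  have X: "X = rcf b t" "\<alpha> \<le> X" using Y[of 0] odd_tails[of 1] yb by (simp_all add: X_def)
  have "X < 1 + \<alpha>"
    unfolding X_def using pos b Ya Y1 \<alpha> by (intro rcf_less_one_add) auto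
  then have 1: "follows \<alpha> \<alpha> [Dig 1 (int y + 1)] (X - 1)"
    using X \<alpha> t(3) yb by (intro follows_pos) auto
  have tails: "\<alpha> \<le> rcf (drop i c) Y" if "even i" "i < length c" for i
    using odd_tails[of "Suc i"] Y[of i] that yb b by simp
  have 2: "follows \<alpha> (X - 1) (word_of c) (Y - 1)"
    unfolding X_def using b pos Ya Y1 \<alpha> tails by (intro follows_word_of) auto
  \<comment> \<open>The block of m, k ends at \<open>t\<close> itself and not at
    \<open>t - 1\<close>, so its digit is k + 1 instead of k + 2; this is the exponent (-1) on the
    hat word.\<close>
  have "real m + 1 / (of_int (int k + 1) - 1 + t) = real m + 1 / (real k + t)" by simp
  then have 3: "follows \<alpha> (Y - 1) (replicate (m - 1) (Dig (-1) 2) @ [Dig (-1) (int k + 1)]) t"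
    using follows_block[of m t \<alpha> "int k + 1"] pos t_ge t(2) kt \<alpha> Ya by (simp add: Y_def)
  have "hat_word_of a = Dig (-1) (2 + int y) # word_of c @ replicate (m - 1) (Dig (-1) 2) @ [Dig (-1) (2 + int k)]"
    using yb b by (simp add: hat_word_of_Cons word_of_append)
  then have "W_word (shift_last (-1) (hat_word_of a)) =
      Dig 1 (int y + 1) # word_of c @ replicate (m - 1) (Dig (-1) 2) @ [Dig (-1) (int k + 1)]"
    by (simp add: shift_last_def butlast_append)
  then show ?thesis
    using follows_Cons[OF 1 follows_append[OF 2 3]] by simp
qed

end

section \<open>The golden mean, and F in terms of quotient lists\<close>

lemma gold_mult: "gold * (1 + gold) = 1" "0 < gold" "gold < 1"
proof -
  have "sqrt 5 * sqrt 5 = 5" by simp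
  then show "gold * (1 + gold) = 1" by (simp add: gold_def field_simps)
  have "1 < sqrt 5" by (simp add: real_less_rsqrt)
  moreover have "sqrt 5 < 3" by (simp add: real_less_lsqrt)
  ultimately show "0 < gold" "gold < 1" by (simp_all add: gold_def)
qed

lemma gold_less_iff:
  assumes "0 \<le> \<alpha>"
  shows "gold < \<alpha> \<longleftrightarrow> 1 < \<alpha> * (1 + \<alpha>)"
proof
  assume "gold < \<alpha>"
  then have "gold * (1 + gold) < \<alpha> * (1 + \<alpha>)"
    using gold_mult by (intro mult_strict_mono) auto
  then show "1 < \<alpha> * (1 + \<alpha>)" using gold_mult by simp
next
  assume "1 < \<alpha> * (1 + \<alpha>)"
  show "gold < \<alpha>"
  proof (rule ccontr)
    assume "\<not> gold < \<alpha>"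
    then have "\<alpha> * (1 + \<alpha>) \<le> gold * (1 + gold)"
      using assms by (intro mult_mono) auto
    then show False using gold_mult \<open>1 < \<alpha> * (1 + \<alpha>)\<close> by simp
  qed
qed

lemma admissible_iff_F_condition:
  assumes "length a = 2 * l + 1"
  shows "admissible a \<longleftrightarrow> (\<forall>j\<in>{1..l}.
           alt_less (drop (2 * j - 1) a) (take (2 * l - 2 * j + 2) a) \<and>
           alt_le (drop (2 * j) a) (take (2 * l - 2 * j + 1) a))"
proof
  assume adm: "admissible a"
  show "\<forall>j\<in>{1..l}. alt_less (drop (2 * j - 1) a) (take (2 * l - 2 * j + 2) a) \<and>
           alt_le (drop (2 * j) a) (take (2 * l - 2 * j + 1) a)"
  proof
    fix j assume j: "j \<in> {1..l}"
    have len: "length a - (2 * j - 1) = 2 * l - 2 * j + 2" "length a - 2 * j = 2 * l - 2 * j + 1"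
      using j assms by auto
    have "0 < 2 * j - 1" "2 * j - 1 < length a" "0 < 2 * j" "2 * j < length a"
      using j assms by auto
    then show "alt_less (drop (2 * j - 1) a) (take (2 * l - 2 * j + 2) a) \<and>
           alt_le (drop (2 * j) a) (take (2 * l - 2 * j + 1) a)"
      using admissibleD(2)[OF adm, of "2 * j - 1"] admissibleD(1)[OF adm, of "2 * j"]
      unfolding len by simp
  qed
next
  assume R: "\<forall>j\<in>{1..l}. alt_less (drop (2 * j - 1) a) (take (2 * l - 2 * j + 2) a) \<and>
           alt_le (drop (2 * j) a) (take (2 * l - 2 * j + 1) a)"
  show "admissible a"
    unfolding admissible_def
  proof (intro allI impI)
    fix i assume i: "0 < i \<and> i < length a"
    show "dominated (drop i a) (take (length a - i) a)"
    proof (cases "even i")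
      case True
      then obtain j where j: "i = 2 * j" by (elim evenE)
      have "length a - i = 2 * l - 2 * j + 1" "j \<in> {1..l}" "odd (length a - i)"
        using i j assms by auto
      then show ?thesis using R j by (simp add: dominated_def)
    next
      case False
      then obtain j' where "i = 2 * j' + 1" by (elim oddE)
      moreover define j where "j = Suc j'"
      ultimately have j: "i = 2 * j - 1" "1 \<le> j" by simp_all
      have "j \<le> l" using i j assms by linarith
      then have "length a - i = 2 * l - 2 * j + 2" "j \<in> {1..l}"
        using j assms by auto
      moreover have "even (2 * l - 2 * j + 2)" by simp
      ultimately show ?thesis using R j by (simp add: dominated_def)
    qed
  qed
qed

lemma F_iff: "v \<in> F \<longleftrightarrow> (\<exists>a. odd (length a) \<and> pos_quots a \<and> admissible a \<and> v = word_of a)"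
proof
  assume "v \<in> F"
  then obtain l where v: "v \<in> lists A_minus" and l: "length (char_seq v) = 2 * l + 1"
    and "\<forall>j\<in>{1..l}.
           alt_less (drop (2 * j - 1) (char_seq v)) (take (2 * l - 2 * j + 2) (char_seq v)) \<and>
           alt_le (drop (2 * j) (char_seq v)) (take (2 * l - 2 * j + 1) (char_seq v))"
    unfolding F_def by blast
  then have "admissible (char_seq v)"
    using admissible_iff_F_condition by blast
  then show "\<exists>a. odd (length a) \<and> pos_quots a \<and> admissible a \<and> v = word_of a"
    using char_seq_works[OF v] unfolding is_char_seq_def by blast
next
  assume "\<exists>a. odd (length a) \<and> pos_quots a \<and> admissible a \<and> v = word_of a"
  then obtain a where a: "odd (length a)" "pos_quots a" "admissible a" "v = word_of a" by blast
  then obtain l where l: "length a = 2 * l + 1" by (elim oddE)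
  have "char_seq v = a" using hat_word_of(1)[OF a(2,1)] a(4) by simp
  moreover have "v \<in> lists A_minus" using a(4) word_of_in_A_minus by simp
  ultimately show "v \<in> F"
    using a(3) l admissible_iff_F_condition[OF l] unfolding F_def by blast
qed

text \<open>After |v| and |hat v| steps the orbits stand at x and -x/(1 + x), the situation of
  \<open>T_conjugate\<close>; the clause for the empty word keeps step 0 from being used as a
  witness for \<open>Gam\<close>.\<close>

lemma matching_follows:
  assumes "v \<in> F" "\<alpha> \<in> Gam_word v"
  obtains x where "0 < \<alpha>" "\<alpha> \<le> 1" "- 1 < x" "v = [] \<Longrightarrow> x \<le> 0"
    "follows \<alpha> (\<alpha> - 1) v x"
    "follows \<alpha> \<alpha> (W_word (shift_last (-1) (hat v))) (- x / (1 + x))"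
proof -
  obtain a where a: "odd (length a)" "pos_quots a" "admissible a" and v: "v = word_of a"
    using assms(1) F_iff by blast
  note hat = hat_word_of(2)[OF a(2,1)]
  show ?thesis
  proof (cases "a = [1]")
    case True
    have "v = []" by (simp add: v True)
    then have \<alpha>: "gold < \<alpha>" "\<alpha> \<le> 1"
      using assms(2) by (auto simp: Gam_word_def)
    then have "0 < \<alpha>" using gold_mult by simp
    then have "1 < \<alpha> * (1 + \<alpha>)" using gold_less_iff[of \<alpha>] \<alpha> by simp
    \<comment> \<open>For the empty word x is \<alpha> - 1 itself, and its conjugate 1/\<alpha> - 1
      is reached from \<alpha> by the letter \<open>(+1:1)\<close>.\<close>
    define z where "z = - (\<alpha> - 1) / (1 + (\<alpha> - 1))"
    have z: "z = 1 / \<alpha> - 1"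
      using \<open>0 < \<alpha>\<close> by (simp add: z_def field_simps)
    have "1 / \<alpha> < 1 + \<alpha>" "1 \<le> 1 / \<alpha>"
      using \<open>1 < \<alpha> * (1 + \<alpha>)\<close> \<open>0 < \<alpha>\<close> \<alpha> by (simp_all add: divide_less_eq mult.commute)
    then have "z \<in> {\<alpha> - 1..<\<alpha>}" using \<alpha> z by simp
    then have "follows \<alpha> \<alpha> [Dig 1 1] z"
      by (rule follows_pos) (use \<open>0 < \<alpha>\<close> z in auto)
    moreover have "W_word (shift_last (-1) (hat v)) = [Dig 1 1]"
      using hat by (simp add: v True shift_last_def)
    ultimately show ?thesis
      using that[of "\<alpha> - 1"] \<open>0 < \<alpha>\<close> \<alpha> \<open>v = []\<close> by (simp add: z_def)
  next
    case False
    obtain t where "0 < \<alpha>" "\<alpha> < 1" "- \<alpha> / (1 + \<alpha>) < t" "t < \<alpha>" "rcf a t = \<alpha>"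
      using assms(2) unfolding v Gam_word_iff[OF a(2,1) False] by blast
    moreover have "v \<noteq> []" using word_of_eq_Nil[OF a(2) a(1)] False v by simp
    ultimately interpret matching a \<alpha> t
      by unfold_locales (use a False in auto)
    show ?thesis
      using that[of x] follows_lower follows_upper x_bounds \<alpha> hat \<open>v \<noteq> []\<close> by (simp add: v)
  qed
qed

section \<open>Consequences of matching on an interval\<close>

lemma follows_stake: "follows \<beta> x w z \<Longrightarrow> stake (length w) (expansion \<beta> x) = w"
  by (simp add: follows_def stake_shift)

lemma follows_snth:
  assumes "follows \<beta> x w z"
  shows "expansion \<beta> x !! length w = letter_at \<beta> z"
proof -
  have "(w @- expansion \<beta> z) !! length w = shd (expansion \<beta> z)"
    by (induction w) simp_all
  then show ?thesis using assms by (simp add: follows_def expansion_def)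
qed

lemma follows_funpow_Suc: "follows \<beta> x w z \<Longrightarrow> (T \<beta> ^^ (length w + 1)) x = T \<beta> z"
  by (simp add: follows_def)

lemma length_W_shift [simp]: "length (W_word (shift_last k w)) = length w"
proof -
  have "length (W_word u) = length u" for u by (cases u) auto
  moreover have "length (shift_last k w) = length w" by (simp add: shift_last_def)
  ultimately show ?thesis by simp
qed

lemma hat_nonempty:
  assumes "v \<in> F"
  shows "0 < length (hat v)"
proof -
  obtain a where "odd (length a)" "pos_quots a" "v = word_of a"
    using assms F_iff by blast
  then show ?thesis using hat_word_of(2)[of a] length_hat_word_of[of a] by simp
qed

lemma matching_properties:
  assumes "v \<in> F" "\<alpha> \<in> Gam_word v"
  shows "stake (length v) (lower \<alpha>) = v"
    and "stake (length (hat v)) (upper \<alpha>) = W_word (shift_last (-1) (hat v))"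
    and "upper \<alpha> !! length (hat v) = W (lower \<alpha> !! length v)"
    and "(T \<alpha> ^^ (length v + 1)) (\<alpha> - 1) = (T \<alpha> ^^ (length (hat v) + 1)) \<alpha>"
proof -
  obtain x where x: "- 1 < x" and
    lo: "follows \<alpha> (\<alpha> - 1) v x" and
    up: "follows \<alpha> \<alpha> (W_word (shift_last (-1) (hat v))) (- x / (1 + x))"
    by (rule matching_follows[OF assms]) blast
  note W = T_conjugate[OF x refl, of \<alpha>]
  show "stake (length v) (lower \<alpha>) = v"
    using follows_stake[OF lo] by (simp add: lower_def)
  show "stake (length (hat v)) (upper \<alpha>) = W_word (shift_last (-1) (hat v))"
    using follows_stake[OF up] by (simp add: upper_def)
  show "upper \<alpha> !! length (hat v) = W (lower \<alpha> !! length v)"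
    using follows_snth[OF up] follows_snth[OF lo] W(1) by (simp add: upper_def lower_def)
  show "(T \<alpha> ^^ (length v + 1)) (\<alpha> - 1) = (T \<alpha> ^^ (length (hat v) + 1)) \<alpha>"
    using follows_funpow_Suc[OF up] follows_funpow_Suc[OF lo] W(2) unfolding length_W_shift by simp
qed

text \<open>The points x and -x/(1 + x) have opposite signs or both vanish, so one of the two orbits
  is nonnegative at its matching time.\<close>

lemma Gam_word_subset_Gam:
  assumes "v \<in> F"
  shows "Gam_word v \<subseteq> Gam"
proof
  fix \<alpha> assume \<alpha>: "\<alpha> \<in> Gam_word v"
  obtain x where \<alpha>01: "0 < \<alpha>" "\<alpha> \<le> 1" and x: "- 1 < x" "v = [] \<Longrightarrow> x \<le> 0" and
    lo: "follows \<alpha> (\<alpha> - 1) v x" and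
    up: "follows \<alpha> \<alpha> (W_word (shift_last (-1) (hat v))) (- x / (1 + x))"
    by (rule matching_follows[OF assms \<alpha>]) blast
  have "\<exists>n\<ge>1. (T \<alpha> ^^ n) (\<alpha> - 1) \<ge> 0 \<or> (T \<alpha> ^^ n) \<alpha> \<ge> 0"
  proof (cases "x \<le> 0")
    case True
    have "0 \<le> - x / (1 + x)" using True x by (intro divide_nonneg_pos) auto
    then have "0 \<le> (T \<alpha> ^^ length (hat v)) \<alpha>"
      using up by (simp add: follows_def)
    moreover have "1 \<le> length (hat v)"
      using hat_nonempty[OF assms] by (simp only: Suc_le_eq One_nat_def)
    ultimately show ?thesis by blast
  next
    case False
    then have "0 \<le> (T \<alpha> ^^ length v) (\<alpha> - 1)" "1 \<le> length v"
      using lo x(2) by (auto simp: follows_def Suc_le_eq)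
    then show ?thesis by blast
  qed
  then show "\<alpha> \<in> Gam" using \<alpha>01 by (simp add: Gam_def)
qed

section \<open>Disjointness of the matching intervals\<close>

lemma hat_word_of_tl:
  assumes "odd (length a)"
  shows "tl (hat_word_of a) = word_of (tl a)"
proof -
  obtain y b where "a = y # b" "even (length b)" using assms by (cases a) auto
  then show ?thesis by (simp add: hat_word_of_Cons)
qed

lemma W_shift_nth_negative:
  assumes "v \<in> F" "0 < i" "i < length (hat v)"
  shows "\<exists>d. W_word (shift_last (-1) (hat v)) ! i = Dig (-1) d"
proof -
  obtain a where a: "odd (length a)" "pos_quots a" "v = word_of a"
    using assms F_iff by blast
  define u where "u = hat v"
  have u: "tl u \<in> lists A_minus" "u \<noteq> []"
    using hat_word_of(2)[of a] a hat_word_of_tl[OF a(1)] word_of_in_A_minus assms(3)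
    by (auto simp: u_def)
  have *: "\<exists>d. u ! j = Dig (-1) d" if "0 < j" "j < length u" for j
  proof -
    have "u ! j = tl u ! (j - 1)" "j - 1 < length (tl u)" using that by (auto simp: nth_tl)
    then have "u ! j \<in> A_minus" using u(1) by (metis in_lists_conv_set nth_mem)
    then show ?thesis by (auto simp: A_minus_def)
  qed
  obtain d where d: "u ! i = Dig (-1) d" using *[of i] assms by (auto simp: u_def)
  have sh: "shift_last (-1) u ! i = (if i = length u - 1 then shift_digit (-1) (u ! i) else u ! i)"
    using u(2) assms(3) by (auto simp: shift_last_def nth_append nth_butlast last_conv_nth u_def)
  have "W_word w ! i = w ! i" for w using assms(2) by (cases w) auto
  then show ?thesis using sh d by (auto simp: u_def)
qed

lemma W_inj: "W x = W y \<Longrightarrow> x = y"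
  by (cases x; cases y) auto

lemma W_shift_inj:
  assumes "W_word (shift_last k u) = W_word (shift_last k w)" "u \<noteq> []" "w \<noteq> []"
  shows "u = w"
proof -
  have W: "W_word x = W_word y \<Longrightarrow> x = y" for x y
    by (cases x; cases y) (auto dest: W_inj)
  have "shift_digit k x = shift_digit k y \<Longrightarrow> x = y" for x y
    by (cases x; cases y) auto
  then show ?thesis
    using W[OF assms(1)] assms(2,3) by (auto simp: shift_last_def) (metis append_butlast_last_id)
qed

text \<open>If \<alpha> lies in two intervals, the shorter word v is a prefix of w. When it is
  proper, the letter of \<open>lower \<alpha>\<close> after v is negative, so by matching the letter
  of \<open>upper \<alpha>\<close> after the hat of v is positive; this forces the two hats to
  coincide.\<close>

lemma disjoint_Gam_word: "disjoint_family_on Gam_word F"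
proof -
  have *: "v = w" if vw: "v \<in> F" "w \<in> F" and \<alpha>: "\<alpha> \<in> Gam_word v" "\<alpha> \<in> Gam_word w"
    and le: "length v \<le> length w" for v w \<alpha>
  proof (cases "length v = length w")
    case True
    then show ?thesis using matching_properties(1)[OF vw(1) \<alpha>(1)] matching_properties(1)[OF vw(2) \<alpha>(2)] by metis
  next
    case False
    obtain a where a: "odd (length a)" "pos_quots a" "v = word_of a" using vw F_iff by blast
    obtain b where b: "odd (length b)" "pos_quots b" "w = word_of b" using vw F_iff by blast
    have lt: "length v < length w" using False le by simp
    have "take (length v) w = take (length v) (stake (length w) (lower \<alpha>))"
      by (simp only: matching_properties(1)[OF vw(2) \<alpha>(2)])
    also have "\<dots> = stake (length v) (lower \<alpha>)"
      using le by (simp add: take_stake min_def)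
    also have "\<dots> = v" by (rule matching_properties(1)[OF vw(1) \<alpha>(1)])
    finally obtain w' where w': "w = v @ w'" by (metis append_take_drop_id)
    have "lower \<alpha> !! length v = stake (length w) (lower \<alpha>) ! length v"
      using lt by (simp add: stake_nth)
    then have "lower \<alpha> !! length v = w ! length v"
      by (simp only: matching_properties(1)[OF vw(2) \<alpha>(2)])
    moreover have "w ! length v \<in> A_minus"
      using nth_mem[OF lt] b(3) word_of_in_A_minus[of b] by auto
    ultimately obtain d where "lower \<alpha> !! length v = Dig (-1) d" by (auto simp: A_minus_def)
    then have pos: "upper \<alpha> !! length (hat v) = Dig 1 (d - 1)"
      using matching_properties(3)[OF vw(1) \<alpha>(1)] by simp
    \<comment> \<open>Otherwise the positive letter would stand inside the upper word of w, past its
      first letter, where all letters are negative.\<close>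
    have "length (hat w) \<le> length (hat v)"
    proof (rule ccontr)
      assume "\<not> ?thesis"
      then have lt: "length (hat v) < length (hat w)" by simp
      have "upper \<alpha> !! length (hat v) = stake (length (hat w)) (upper \<alpha>) ! length (hat v)"
        using lt by (simp add: stake_nth)
      then have "upper \<alpha> !! length (hat v) = W_word (shift_last (-1) (hat w)) ! length (hat v)"
        by (simp only: matching_properties(2)[OF vw(2) \<alpha>(2)])
      then show False
        using W_shift_nth_negative[OF vw(2) hat_nonempty[OF vw(1)] lt] pos by auto
    qed
    \<comment> \<open>The hat length is one plus the total excess, which can only grow from a prefix
      to the whole word.\<close>
    moreover have "length (hat v) \<le> length (hat w)"
    proof -
      have "sum_list (map excess v) \<le> sum_list (map excess w)"
        by (simp add: w')
      then show ?thesis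
        using hat_word_of(2)[OF a(2,1)] hat_word_of(2)[OF b(2,1)]
          length_hat_word_of[OF a(1,2)] length_hat_word_of[OF b(1,2)] a(3) b(3) by simp
    qed
    ultimately have "length (hat v) = length (hat w)" by simp
    then have "W_word (shift_last (-1) (hat v)) = W_word (shift_last (-1) (hat w))"
      using matching_properties(2)[OF vw(1) \<alpha>(1)] matching_properties(2)[OF vw(2) \<alpha>(2)] by metis
    moreover have "hat v \<noteq> []" "hat w \<noteq> []"
      using hat_nonempty[OF vw(1)] hat_nonempty[OF vw(2)] by auto
    ultimately have "hat v = hat w" by (rule W_shift_inj)
    then have "hat_word_of a = hat_word_of b"
      using hat_word_of(2)[OF a(2,1)] hat_word_of(2)[OF b(2,1)] a(3) b(3) by metis
    then have "a = b"
      by (rule hat_word_of_inj[OF a(1) b(1) a(2) b(2)])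
    then show ?thesis using a b by simp
  qed
  show ?thesis
    unfolding disjoint_family_on_def
  proof (intro ballI impI)
    fix v w assume vw: "v \<in> F" "w \<in> F" "v \<noteq> w"
    show "Gam_word v \<inter> Gam_word w = {}"
    proof (rule ccontr)
      assume "Gam_word v \<inter> Gam_word w \<noteq> {}"
      then obtain \<alpha> where "\<alpha> \<in> Gam_word v" "\<alpha> \<in> Gam_word w" by blast
      then show False using *[of v w \<alpha>] *[of w v \<alpha>] vw
        by (cases "length v \<le> length w") auto
    qed
  qed
qed

section \<open>Points whose Gauss orbit falls below them lie in a matching interval\<close>

lemma ex_Gam_word:
  assumes \<alpha>: "0 < \<alpha>" "\<alpha> \<le> 1" and ex: "(gauss ^^ m) \<alpha> < \<alpha>"
  shows "\<exists>v\<in>F. \<alpha> \<in> Gam_word v"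
proof (cases "gold < \<alpha>")
  case True
  have "[] \<in> F"
    unfolding F_iff by (intro exI[of _ "[1]"]) (simp add: admissible_def)
  moreover have "\<alpha> \<in> Gam_word []" using True \<alpha> by (simp add: Gam_word_def)
  ultimately show ?thesis by blast
next
  case False
  then have golden: "\<alpha> * (1 + \<alpha>) \<le> 1" "\<alpha> < 1"
    using gold_less_iff[of \<alpha>] \<alpha> gold_mult by auto
  define n where "n = (LEAST n. (gauss ^^ n) \<alpha> < \<alpha>)"
  define x where "x = (gauss ^^ n) \<alpha>"
  define l where "l = quots n \<alpha>"
  have xa: "x < \<alpha>" unfolding x_def n_def by (rule LeastI[of _ m]) (rule ex)
  have ge: "\<alpha> \<le> (gauss ^^ i) \<alpha>" if "i < n" for i
    using not_less_Least[of i "\<lambda>n. (gauss ^^ n) \<alpha> < \<alpha>"] that by (simp add: n_def)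
  have n: "0 < n" using xa by (cases n) (auto simp: x_def)
  have x0: "0 \<le> x" "x < 1" using funpow_gauss_bounds[OF \<alpha>(1) golden(2)]
    by (simp_all add: x_def)
  have pos_orbit: "0 < (gauss ^^ i) \<alpha>" if "i < n" for i using ge[OF that] \<alpha> by simp
  have l: "pos_quots l" "length l = n" "rcf l x = \<alpha>"
    using pos_quots_quots[OF \<alpha>(1) golden(2), of n] rcf_quots[of n \<alpha>] pos_orbit
    by (auto simp: l_def x_def)
  have adm: "admissible l"
    unfolding admissible_def
  proof (intro allI impI)
    fix i assume "0 < i \<and> i < length l"
    then have i: "0 < i" "i < n" "0 < n - i" "n - i < n" by (auto simp: l)
    define s where "s = drop i l"
    define p where "p = take (n - i) l"
    \<comment> \<open>\<open>p\<close> with tail \<open>u\<close> expands \<alpha> and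
      \<open>s\<close> with tail \<open>x\<close> expands the i-th iterate, which is at least
      \<alpha> by minimality of n; so \<open>p\<close> cannot precede \<open>s\<close> in the
      alternating order.\<close>
    define u where "u = (gauss ^^ (n - i)) \<alpha>"
    have u: "\<alpha> \<le> u" "u < 1"
      using ge[OF i(4)] funpow_gauss_bounds[OF \<alpha>(1) golden(2)] by (simp_all add: u_def)
    have sp: "pos_quots s" "pos_quots p" "length s = length p" "length s = n - i"
      using pos_quots_take_drop[OF l(1)] l(2) i by (auto simp: s_def p_def)
    have "rcf p u = \<alpha>"
      using rcf_quots[of "n - i" \<alpha>] pos_orbit i by (simp add: p_def u_def l_def take_quots)
    moreover have "rcf s x = (gauss ^^ i) \<alpha>"
    proof -
      have "rcf (quots (n - i) ((gauss ^^ i) \<alpha>)) ((gauss ^^ (n - i)) ((gauss ^^ i) \<alpha>)) = (gauss ^^ i) \<alpha>"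
      proof (rule rcf_quots)
        fix j assume "j < n - i"
        then show "0 < (gauss ^^ j) ((gauss ^^ i) \<alpha>)"
          using pos_orbit[of "j + i"] by (simp add: funpow_add)
      qed
      moreover have "(gauss ^^ (n - i)) ((gauss ^^ i) \<alpha>) = (gauss ^^ (n - i + i)) \<alpha>"
        by (simp add: funpow_add)
      ultimately show ?thesis using i by (simp add: s_def l_def drop_quots x_def)
    qed
    ultimately have le: "rcf p u \<le> rcf s x" using ge[OF i(2)] by simp
    have "\<not> alt_less p s"
    proof
      assume "alt_less p s"
      then have "rcf s x < rcf p u"
        by (rule rcf_alt_less) (use sp u x0 \<alpha> in auto)
      then show False using le by simp
    qed
    then have "alt_less s p \<or> s = p" using alt_less_linear[OF sp(3)] by blast
    \<comment> \<open>For a common word of even length the branch is increasing, and x < \<alpha>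
      \<le> u contradicts the order of the values.\<close>
    moreover have "s \<noteq> p" if "even (length s)"
    proof
      assume "s = p"
      then have "rcf s x < rcf p u"
        using rcf_less_iff[OF sp(1), of x u] that x0 xa u by simp
      then show False using le by simp
    qed
    ultimately show "dominated (drop i l) (take (length l - i) l)"
      using l(2) by (auto simp: dominated_def alt_le_def s_def p_def)
  qed
  have "\<exists>a t. odd (length a) \<and> pos_quots a \<and> a \<noteq> [1] \<and> admissible a \<and> rcf a t = \<alpha> \<and>
      - \<alpha> / (1 + \<alpha>) < t \<and> t < \<alpha>"
  proof (cases "odd n")
    case True
    have "l \<noteq> [1]"
    proof
      assume "l = [1]"
      then have "\<alpha> = 1 / (1 + x)" using l(3) by simp
      then have "1 = \<alpha> * (1 + x)" using x0 by simp
      also have "\<dots> < \<alpha> * (1 + \<alpha>)" using xa \<alpha> by simp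
      finally show False using golden by simp
    qed
    moreover have "- \<alpha> / (1 + \<alpha>) < 0" using \<alpha> by (simp add: divide_neg_pos)
    then have "- \<alpha> / (1 + \<alpha>) < x" using x0 by linarith
    ultimately show ?thesis using True l adm xa by blast
  next
    case False
    \<comment> \<open>For even n the odd twin takes over. Its tail is -x/(1 + x), which exceeds
      -\<alpha>/(1 + \<alpha>) because x < \<alpha>.\<close>
    then have "l \<noteq> [1]" "l \<noteq> []" using l(2) n by auto
    then obtain a where "twin l a" using ex_twin[OF l(1)] by blast
    then have tw: "twin a l" by (rule twin_sym)
    have "x / (1 + x) < \<alpha> / (1 + \<alpha>)"
      using x0 xa \<alpha> by (simp add: field_simps)
    then have "- \<alpha> / (1 + \<alpha>) < - x / (1 + x)" by simp
    moreover have "0 \<le> x / (1 + x)" using x0 by simp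
    then have "- x / (1 + x) < \<alpha>" using \<alpha> by simp
    moreover have "rcf a (- x / (1 + x)) = \<alpha>" using rcf_twin[OF tw x0(1)] l(3) by simp
    moreover have "odd (length a)" "pos_quots a" "a \<noteq> [1]" "admissible a"
      using twin_even[OF tw] twin_pos_quots[OF tw] twin_ne[OF tw] twin_admissible[OF tw] l adm False by auto
    ultimately show ?thesis by blast
  qed
  then obtain a t where a: "odd (length a)" "pos_quots a" "a \<noteq> [1]" "admissible a" and
    t: "rcf a t = \<alpha>" "- \<alpha> / (1 + \<alpha>) < t" "t < \<alpha>" by blast
  have "\<alpha> \<in> Gam_word (word_of a)"
    unfolding Gam_word_iff[OF a(2,1,3)] using t \<alpha> golden by blast
  moreover have "word_of a \<in> F" unfolding F_iff using a by blast
  ultimately show ?thesis by blast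
qed

section \<open>The exceptional set\<close>

definition digits :: "real \<Rightarrow> nat stream" where
  "digits y = smap (\<lambda>i. quot ((gauss ^^ i) y)) nats"

lemma snth_digits [simp]: "digits y !! n = quot ((gauss ^^ n) y)"
  by (simp add: digits_def)

lemma stream_eqI: "(\<And>n. s !! n = t !! n) \<Longrightarrow> s = t"
  by (metis ext stream_smap_nats)

lemma sdrop_digits: "sdrop n (digits y) = digits ((gauss ^^ n) y)"
  by (rule stream_eqI) (simp add: sdrop_snth funpow_add add.commute[of n])

lemma stl_digits: "stl (digits y) = digits (gauss y)"
  using sdrop_digits[of 1 y] by simp

lemma stake_digits: "stake n (digits y) = quots n y"
  by (rule nth_equalityI) (simp_all add: quots_def stake_nth)

text \<open>Coinduction that consumes a whole nonempty block at each step, by strong induction on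
  the position.\<close>

lemma stream_prefix_coinduct:
  assumes "R s t"
    and step: "\<And>s t. R s t \<Longrightarrow> \<exists>p s' t'. p \<noteq> [] \<and> s = p @- s' \<and> t = p @- t' \<and> R s' t'"
  shows "s = t"
proof (rule stream_eqI)
  fix n
  show "s !! n = t !! n"
    using assms(1)
  proof (induction n arbitrary: s t rule: less_induct)
    case (less n)
    obtain p s' t' where p: "p \<noteq> []" "s = p @- s'" "t = p @- t'" "R s' t'"
      using step[OF less.prems] by blast
    show ?case
    proof (cases "n < length p")
      case True
      then show ?thesis using p by simp
    next
      case False
      then have "n - length p < n" using p(1) by (cases n) auto
      then show ?thesis using less.IH[OF _ p(4)] False p by (simp add: shift_snth)
    qed
  qed
qed

lemma shd_digits [simp]: "shd (digits y) = quot y"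
  using snth_digits[of y 0] by simp

lemma smap_nats: "smap f nats = f 0 ## smap (\<lambda>j. f (Suc j)) nats"
proof (rule stream_eqI)
  show "smap f nats !! n = (f 0 ## smap (\<lambda>j. f (Suc j)) nats) !! n" for n
    by (cases n) simp_all
qed

lemma word_of_inf_unfold:
  "word_of_inf b = (replicate (b !! 0 - 1) (Dig (-1) 2) @ [Dig (-1) (2 + int (b !! 1))])
     @- word_of_inf (sdrop 2 b)"
  unfolding word_of_inf_def by (subst smap_nats) (simp add: sdrop_snth numeral_3_eq_3)

lemma hat_word_of_inf_unfold:
  "hat_word_of_inf b = (Dig (-1) (2 + int (b !! 0)) # replicate (b !! 1 - 1) (Dig (-1) 2))
     @- hat_word_of_inf (sdrop 2 b)"
  unfolding hat_word_of_inf_def by (subst smap_nats) (simp add: sdrop_snth numeral_3_eq_3)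

lemma hat_word_of_inf_eq: "hat_word_of_inf b = Dig (-1) (2 + int (shd b)) ## word_of_inf (stl b)"
proof -
  define R where "R s t \<longleftrightarrow> (\<exists>b. s = hat_word_of_inf b \<and> t = Dig (-1) (2 + int (shd b)) ## word_of_inf (stl b))" for s t
  show ?thesis
  proof (rule stream_prefix_coinduct[of R])
    show "R (hat_word_of_inf b) (Dig (-1) (2 + int (shd b)) ## word_of_inf (stl b))"
      by (auto simp: R_def)
  next
    fix s t assume "R s t"
    then obtain b where st: "s = hat_word_of_inf b" "t = Dig (-1) (2 + int (shd b)) ## word_of_inf (stl b)"
      by (auto simp: R_def)
    define p where "p = Dig (-1) (2 + int (b !! 0)) # replicate (b !! 1 - 1) (Dig (-1) 2)"
    have "s = p @- hat_word_of_inf (sdrop 2 b)"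
      unfolding st p_def by (rule hat_word_of_inf_unfold)
    moreover have "t = p @- (Dig (-1) (2 + int (shd (sdrop 2 b))) ## word_of_inf (stl (sdrop 2 b)))"
      unfolding st p_def by (subst word_of_inf_unfold) (simp add: numeral_2_eq_2)
    moreover have "p \<noteq> []" by (simp add: p_def)
    ultimately show "\<exists>p s' t'. p \<noteq> [] \<and> s = p @- s' \<and> t = p @- t' \<and> R s' t'"
      unfolding R_def by blast
  qed
qed

text \<open>Each bisimulation step spends two quotients and one block, so the lower bound concerns
  even iterates only. It serves for \<beta> = 0, the by-excess expansion, and for \<beta> =
  \<alpha>.\<close>

lemma expansion_eq_word_of_inf:
  assumes y: "0 < y" "y < 1" and \<beta>: "0 \<le> \<beta>"
    and orbit: "\<And>n. 0 < (gauss ^^ n) y" "\<And>n. even n \<Longrightarrow> \<beta> \<le> (gauss ^^ n) y"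
  shows "expansion \<beta> (y - 1) = word_of_inf (digits y)"
proof -
  define Inv where "Inv y \<longleftrightarrow> y < 1 \<and> (\<forall>n. 0 < (gauss ^^ n) y) \<and> (\<forall>n. even n \<longrightarrow> \<beta> \<le> (gauss ^^ n) y)" for y
  define R where "R s t \<longleftrightarrow> (\<exists>y. Inv y \<and> s = expansion \<beta> (y - 1) \<and> t = word_of_inf (digits y))" for s t
  show ?thesis
  proof (rule stream_prefix_coinduct[of R])
    show "R (expansion \<beta> (y - 1)) (word_of_inf (digits y))"
      using assms by (auto simp: R_def Inv_def)
  next
    fix s t assume "R s t"
    then obtain y where st: "s = expansion \<beta> (y - 1)" "t = word_of_inf (digits y)" and "Inv y"
      by (auto simp: R_def)
    define y' where "y' = gauss (gauss y)"
    have y: "y < 1" "0 < (gauss ^^ n) y" "even n \<Longrightarrow> \<beta> \<le> (gauss ^^ n) y" for n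
      using \<open>Inv y\<close> by (auto simp: Inv_def)
    have pos: "0 < y" "0 < gauss y" "0 < y'"
      using y(2)[of 0] y(2)[of 1] y(2)[of 2] by (simp_all add: y'_def numeral_2_eq_2)
    have "Inv y'"
      unfolding Inv_def
    proof (intro conjI allI impI)
      show "y' < 1" using gauss_bounds by (simp add: y'_def)
      have shift: "(gauss ^^ n) y' = (gauss ^^ (Suc (Suc n))) y" for n
        by (simp add: y'_def funpow_swap1)
      show "0 < (gauss ^^ n) y'" for n unfolding shift by (rule y(2))
      show "\<beta> \<le> (gauss ^^ n) y'" if "even n" for n
        unfolding shift by (rule y(3)) (use that in simp)
    qed
    define p where "p = replicate (quot y - 1) (Dig (-1) 2) @ [Dig (-1) (2 + int (quot (gauss y)))]"
    have yeq: "y = 1 / (real (quot y) + 1 / (of_int (2 + int (quot (gauss y))) - 1 + (y' - 1)))"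
      using gauss_step[OF pos(1)] gauss_step[OF pos(2)] by (simp add: y'_def)
    have "follows \<beta> (1 / (real (quot y) + 1 / (of_int (2 + int (quot (gauss y))) - 1 + (y' - 1))) - 1) p (y' - 1)"
      unfolding p_def
    proof (rule follows_block)
      show "1 \<le> quot y" using quot_pos pos y(1) by simp
      have "y' < 1" using gauss_bounds by (simp add: y'_def)
      moreover have "\<beta> \<le> y'" using y(3)[of 2] by (simp add: y'_def numeral_2_eq_2)
      ultimately show "y' - 1 \<in> {\<beta> - 1..<\<beta>}" using \<beta> by simp
      show "0 < of_int (2 + int (quot (gauss y))) - 1 + (y' - 1)" using pos by simp
      show "\<beta> \<le> 1 / (real (quot y) + 1 / (of_int (2 + int (quot (gauss y))) - 1 + (y' - 1)))"
        using y(3)[of 0] yeq by simp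
    qed (rule \<beta>)
    then have "s = p @- expansion \<beta> (y' - 1)"
      unfolding yeq[symmetric] st follows_def by simp
    moreover have "t = p @- word_of_inf (digits y')"
      unfolding st p_def by (subst word_of_inf_unfold) (simp add: stl_digits y'_def numeral_2_eq_2)
    moreover have "R (expansion \<beta> (y' - 1)) (word_of_inf (digits y'))"
      using \<open>Inv y'\<close> by (auto simp: R_def)
    moreover have "p \<noteq> []" by (simp add: p_def)
    ultimately show "\<exists>p s' t'. p \<noteq> [] \<and> s = p @- s' \<and> t = p @- t' \<and> R s' t'" by blast
  qed
qed

section \<open>Uniqueness of infinite characteristic sequences\<close>

lemma word_of_inf_in_streams: "word_of_inf b \<in> streams A_minus"
proof (rule sset_streams)
  have "set (replicate n (Dig (-1) 2) @ [Dig (-1) (2 + int m)]) \<subseteq> A_minus" for n m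
    by (auto simp: A_minus_def)
  then show "sset (word_of_inf b) \<subseteq> A_minus"
    unfolding word_of_inf_def by (subst sset_flat) (auto simp: stream.set_map)
qed

lemma twos_prefix_stream_eqD:
  assumes "replicate p (Dig (-1) 2) @- Dig (-1) (2 + int q) ## v
         = replicate p' (Dig (-1) 2) @- Dig (-1) (2 + int q') ## v'" "1 \<le> q" "1 \<le> q'"
  shows "p = p' \<and> q = q' \<and> v = v'"
  using assms(1)
proof (induction p arbitrary: p')
  case 0
  then show ?case using assms(2,3) by (cases p') auto
next
  case (Suc p)
  then show ?case using assms(2,3) by (cases p') auto
qed

lemma word_of_inf_inj:
  assumes "\<And>n. 1 \<le> b !! n" "\<And>n. 1 \<le> c !! n" "word_of_inf b = word_of_inf c"
  shows "b = c"
proof -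
  define R where "R s t \<longleftrightarrow> (\<forall>n. 1 \<le> s !! n) \<and> (\<forall>n. 1 \<le> t !! n) \<and> word_of_inf s = word_of_inf t" for s t
  show ?thesis
  proof (rule stream_prefix_coinduct[of R])
    show "R b c" using assms by (simp add: R_def)
  next
    fix s t assume "R s t"
    then have R: "1 \<le> s !! n" "1 \<le> t !! n" "word_of_inf s = word_of_inf t" for n
      by (auto simp: R_def)
    have "replicate (s !! 0 - 1) (Dig (-1) 2) @- Dig (-1) (2 + int (s !! 1)) ## word_of_inf (sdrop 2 s)
        = replicate (t !! 0 - 1) (Dig (-1) 2) @- Dig (-1) (2 + int (t !! 1)) ## word_of_inf (sdrop 2 t)"
      using R(3) unfolding word_of_inf_unfold[of s] word_of_inf_unfold[of t] by simp
    from twos_prefix_stream_eqD[OF this R(1) R(2)]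
    have *: "s !! 0 - 1 = t !! 0 - 1 \<and> s !! 1 = t !! 1 \<and> word_of_inf (sdrop 2 s) = word_of_inf (sdrop 2 t)" .
    have "s !! 0 = t !! 0" using * R(1)[of 0] R(2)[of 0] by linarith
    moreover have "s = [s !! 0, s !! 1] @- sdrop 2 s" for s :: "nat stream"
      by (simp add: numeral_2_eq_2)
    ultimately have "s = [s !! 0, s !! 1] @- sdrop 2 s \<and> t = [s !! 0, s !! 1] @- sdrop 2 t"
      using * by metis
    moreover have "R (sdrop 2 s) (sdrop 2 t)"
      unfolding R_def sdrop_snth using R(1,2) * by blast
    ultimately show "\<exists>p s' t'. p \<noteq> [] \<and> s = p @- s' \<and> t = p @- t' \<and> R s' t'"
      by (metis list.distinct(1))
  qed
qed

text \<open>Every block closes with a letter \<open>(-1:2+b)\<close>, b \<ge> 1, so from any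
  position a letter other than \<open>(-1:2)\<close> still follows.\<close>

lemma word_of_inf_not_ends_with_twos:
  assumes "\<And>n. 1 \<le> b !! n"
  shows "\<not> ends_with_twos (word_of_inf b)"
proof -
  have "sdrop n (word_of_inf b) \<noteq> sconst (Dig (-1) 2)" for n
    using assms
  proof (induction n arbitrary: b rule: less_induct)
    case (less n)
    define p where "p = replicate (b !! 0 - 1) (Dig (-1) 2) @ [Dig (-1) (2 + int (b !! 1))]"
    have w: "word_of_inf b = p @- word_of_inf (sdrop 2 b)"
      unfolding p_def by (rule word_of_inf_unfold)
    show ?case
    proof (cases "n < length p")
      case True
      define m where "m = length p - 1"
      have m: "n \<le> m" "m < length p" "p ! m = Dig (-1) (2 + int (b !! 1))"
        using True by (auto simp: m_def p_def nth_append)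
      show ?thesis
      proof
        assume "sdrop n (word_of_inf b) = sconst (Dig (-1) 2)"
        then have "sdrop n (word_of_inf b) !! (m - n) = Dig (-1) 2" by simp
        then have "word_of_inf b !! m = Dig (-1) 2" using m by (simp add: sdrop_snth)
        then show False using m less.prems[of 1] by (simp add: w)
      qed
    next
      case False
      then have "n - length p < n" by (cases n) (auto simp: p_def)
      then have "sdrop (n - length p) (word_of_inf (sdrop 2 b)) \<noteq> sconst (Dig (-1) 2)"
        by (rule less.IH) (simp only: sdrop_snth less.prems)
      moreover have "sdrop n (word_of_inf b) = sdrop (n - length p) (word_of_inf (sdrop 2 b))"
        using False by (simp add: w sdrop_shift)
      ultimately show ?thesis by metis
    qed
  qed
  then show ?thesis by (simp add: ends_with_twos_def)
qed

lemma word_of_twos_inj: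
  assumes "even (length b)" "even (length c)" "pos_quots b" "pos_quots c"
    and "word_of b @- sconst (Dig (-1) 2) = word_of c @- sconst (Dig (-1) 2)"
  shows "b = c"
proof -
  define S where "S = sconst (Dig (-1) 2)"
  have no: False if "replicate p (Dig (-1) 2) @- Dig (-1) (2 + int q) ## v = S" "1 \<le> q" for p q v
    using that(1) unfolding S_def
  proof (induction p)
    case 0
    from arg_cong[OF this, of shd] show ?case using that(2) by simp
  next
    case (Suc p)
    from arg_cong[OF Suc.prems, of stl]
    have "replicate p (Dig (-1) 2) @- Dig (-1) (2 + int q) ## v = sconst (Dig (-1) 2)"
      unfolding siterate.simps id_apply by simp
    then show ?case by (rule Suc.IH)
  qed
  have "word_of b @- S = word_of c @- S" using assms(5) by (simp only: S_def)
  with assms(1-4) show ?thesis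
  proof (induction b arbitrary: c rule: word_of.induct)
    case 1
    then show ?case
    proof (cases c rule: word_of.cases)
      case (3 x y d)
      then show ?thesis using 1 no[of "x - 1" y "word_of d @- S"] by simp
    qed auto
  next
    case (3 x y d)
    show ?case
    proof (cases c rule: word_of.cases)
      case 1
      then show ?thesis using 3 no[of "x - 1" y "word_of d @- S"] by simp
    next
      case (2 z)
      then show ?thesis using 3 by simp
    next
      case c: (3 x' y' d')
      have *: "x - 1 = x' - 1 \<and> y = y' \<and>
          word_of d @- S = word_of d' @- S"
        using 3(6) 3(4,5) unfolding c by (intro twos_prefix_stream_eqD) auto
      have "d = d'" by (rule "3.IH") (use "3.prems" c * in simp_all)
      moreover have "1 \<le> x" "1 \<le> x'" using "3.prems" c by simp_all
      then have "x = x'" using * by linarith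
      ultimately show ?thesis using * c by simp
    qed
  qed simp
qed

text \<open>A competing sequence ending in infinities would make the word end in twos; a competing
  finite-valued one is equal by injectivity.\<close>

lemma char_seq_inf_word_of_inf:
  assumes "\<And>n. 1 \<le> b !! n"
  shows "char_seq_inf (word_of_inf b) = smap enat b"
  unfolding char_seq_inf_def
proof (rule the_equality)
  show "is_char_seq_inf (word_of_inf b) (smap enat b)"
    using assms by (auto simp: is_char_seq_inf_def)
next
  fix a assume "is_char_seq_inf (word_of_inf b) a"
  then consider c where "\<forall>n. 1 \<le> c !! n" "word_of_inf b = word_of_inf c" "a = smap enat c"
    | c where "word_of_inf b = word_of c @- sconst (Dig (-1) 2)"
    unfolding is_char_seq_inf_def by blast
  then show "a = smap enat b"
  proof cases
    case 1
    then show ?thesis using word_of_inf_inj[of b c] assms by simp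
  next
    case 2
    then have "ends_with_twos (word_of_inf b)"
      unfolding ends_with_twos_def by (intro exI[of _ "length (word_of c)"]) (simp add: sdrop_shift)
    then show ?thesis using word_of_inf_not_ends_with_twos assms by blast
  qed
qed

lemma char_seq_inf_word_of_twos:
  assumes "even (length b)" "pos_quots b"
  shows "char_seq_inf (word_of b @- sconst (Dig (-1) 2)) = map enat b @- sconst \<infinity>"
  unfolding char_seq_inf_def
proof (rule the_equality)
  show "is_char_seq_inf (word_of b @- sconst (Dig (-1) 2)) (map enat b @- sconst \<infinity>)"
    using assms by (auto simp: is_char_seq_inf_def)
next
  fix a assume "is_char_seq_inf (word_of b @- sconst (Dig (-1) 2)) a"
  then consider c where "\<forall>n. 1 \<le> c !! n" "word_of b @- sconst (Dig (-1) 2) = word_of_inf c"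
    | c where "even (length c)" "pos_quots c" "a = map enat c @- sconst \<infinity>"
       "word_of b @- sconst (Dig (-1) 2) = word_of c @- sconst (Dig (-1) 2)"
    unfolding is_char_seq_inf_def by blast
  then show "a = map enat b @- sconst \<infinity>"
  proof cases
    case 1
    have "ends_with_twos (word_of_inf c)"
      unfolding ends_with_twos_def 1(2)[symmetric]
      by (intro exI[of _ "length (word_of b)"]) (simp add: sdrop_shift)
    then show ?thesis using word_of_inf_not_ends_with_twos 1(1) by blast
  next
    case 2
    then show ?thesis using word_of_twos_inj[of b c] assms by simp
  qed
qed

section \<open>Expansions outside \<open>Gam\<close>\<close>

lemma positive_orbit:
  assumes "0 < \<alpha>" "\<And>n. \<alpha> \<le> (gauss ^^ n) \<alpha>"
  shows "0 < (gauss ^^ n) \<alpha>"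
  using assms(1) assms(2)[of n] by simp

lemma one_le_digits:
  assumes "y < 1" "\<And>n. 0 < (gauss ^^ n) y"
  shows "1 \<le> digits y !! n"
proof -
  have "0 < y" using assms(2)[of 0] by simp
  then have "(gauss ^^ n) y \<le> 1" using funpow_gauss_bounds(2)[of y n] assms(1) by simp
  then show ?thesis using quot_pos[OF assms(2)[of n]] by simp
qed

text \<open>The orbit of \<alpha> - 1 sees the even iterates of \<alpha>. The first letter sends
  \<alpha> to \<open>gauss \<alpha> - 1\<close>, from where the even iterates of
  \<open>gauss \<alpha>\<close>, the odd ones of \<alpha>, are seen.\<close>

lemma lower_upper_exceptional:
  assumes \<alpha>: "0 < \<alpha>" "\<alpha> < 1" and orbit: "\<And>n. \<alpha> \<le> (gauss ^^ n) \<alpha>"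
  shows "lower \<alpha> = word_of_inf (digits \<alpha>)"
    and "upper \<alpha> = W_stream (hat_word_of_inf (digits \<alpha>))"
    and "stl (upper \<alpha>) = word_of_inf (digits (gauss \<alpha>))"
proof -
  note pos = positive_orbit[OF \<alpha>(1) orbit]
  show "lower \<alpha> = word_of_inf (digits \<alpha>)"
    unfolding lower_def using \<alpha> orbit pos by (intro expansion_eq_word_of_inf) auto
  have shift: "(gauss ^^ n) (gauss \<alpha>) = (gauss ^^ (Suc n)) \<alpha>" for n
    by (simp add: funpow_swap1)
  have tail: "expansion \<alpha> (gauss \<alpha> - 1) = word_of_inf (digits (gauss \<alpha>))"
  proof (rule expansion_eq_word_of_inf)
    show "0 < (gauss ^^ n) (gauss \<alpha>)" for n unfolding shift by (rule pos)
    show "\<alpha> \<le> (gauss ^^ n) (gauss \<alpha>)" for n unfolding shift by (rule orbit)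
  qed (use pos[of 1] gauss_bounds \<alpha> in auto)
  have "follows \<alpha> \<alpha> [Dig 1 (int (quot \<alpha>) + 1)] (gauss \<alpha> - 1)"
  proof (rule follows_pos)
    have "gauss \<alpha> < 1" by (rule gauss_bounds)
    then show "gauss \<alpha> - 1 \<in> {\<alpha> - 1..<\<alpha>}"
      using orbit[of 1] \<alpha> by simp
    show "\<alpha> = 1 / (of_int (int (quot \<alpha>) + 1) + (gauss \<alpha> - 1))"
      using gauss_step[OF \<alpha>(1)] by simp
  qed (rule \<alpha>)
  then have up: "upper \<alpha> = Dig 1 (int (quot \<alpha>) + 1) ## word_of_inf (digits (gauss \<alpha>))"
    unfolding upper_def follows_def tail by simp
  then show "stl (upper \<alpha>) = word_of_inf (digits (gauss \<alpha>))" by simp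
  show "upper \<alpha> = W_stream (hat_word_of_inf (digits \<alpha>))"
    unfolding up hat_word_of_inf_eq W_stream_def by (simp add: stl_digits)
qed

lemma letter_at_in_A_minus: "letter_at \<alpha> x \<in> A_minus \<Longrightarrow> x < 0"
  by (auto simp: letter_at_def A_minus_def split: if_splits)

text \<open>An orbit that falls below \<alpha> puts \<alpha> into some interval, hence into
  \<open>Gam\<close>. Otherwise all letters of both expansions, except the first of
  \<open>upper \<alpha>\<close>, lie in \<open>A_minus\<close>, so the iterates are
  negative.\<close>

lemma not_Gam_iff:
  assumes \<alpha>: "0 < \<alpha>" "\<alpha> \<le> 1"
  shows "\<alpha> \<notin> Gam \<longleftrightarrow> (\<forall>n. \<alpha> \<le> (gauss ^^ n) \<alpha>)"
proof
  assume "\<alpha> \<notin> Gam"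
  then have "\<not> (\<exists>v\<in>F. \<alpha> \<in> Gam_word v)"
    using Gam_word_subset_Gam by blast
  then show "\<forall>n. \<alpha> \<le> (gauss ^^ n) \<alpha>"
    using ex_Gam_word[OF \<alpha>] by (meson not_less)
next
  assume orbit: "\<forall>n. \<alpha> \<le> (gauss ^^ n) \<alpha>"
  have "\<alpha> \<le> gauss \<alpha>" using orbit[rule_format, of 1] by simp
  then have "\<alpha> < 1" using gauss_bounds[of \<alpha>] by linarith
  note lu = lower_upper_exceptional[OF \<alpha>(1) this orbit[rule_format]]
  have "(T \<alpha> ^^ n) (\<alpha> - 1) < 0" for n
  proof -
    have "lower \<alpha> !! n \<in> A_minus" unfolding lu(1)
      by (rule snth_in[OF word_of_inf_in_streams])
    then show ?thesis unfolding lower_def expansion_snth by (rule letter_at_in_A_minus)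
  qed
  moreover have "(T \<alpha> ^^ n) \<alpha> < 0" if n: "1 \<le> n" for n
  proof -
    have "stl (upper \<alpha>) !! (n - 1) \<in> A_minus" unfolding lu(3)
      by (rule snth_in[OF word_of_inf_in_streams])
    then have "upper \<alpha> !! n \<in> A_minus" using n by (cases n) auto
    then show ?thesis unfolding upper_def expansion_snth by (rule letter_at_in_A_minus)
  qed
  ultimately show "\<alpha> \<notin> Gam" by (auto simp: Gam_def not_le[symmetric])
qed

text \<open>\<alpha> times its first quotient plus \<open>gauss \<alpha>\<close> is 1, and that sum
  is at least 1 + \<alpha>.\<close>

lemma exceptional_le_gold:
  assumes "0 < \<alpha>" "\<alpha> \<le> 1" "\<alpha> \<le> gauss \<alpha>"
  shows "\<alpha> \<le> gold"
proof (rule ccontr)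
  assume "\<not> \<alpha> \<le> gold"
  then have "1 < \<alpha> * (1 + \<alpha>)" using gold_less_iff[of \<alpha>] assms(1) by simp
  moreover have "\<alpha> * (1 + \<alpha>) \<le> \<alpha> * (quot \<alpha> + gauss \<alpha>)"
    using assms quot_pos[of \<alpha>] by (intro mult_left_mono add_mono) auto
  moreover have "\<alpha> * (quot \<alpha> + gauss \<alpha>) = 1"
  proof -
    define q where "q = quot \<alpha> + gauss \<alpha>"
    have "\<alpha> = 1 / q" using gauss_step[OF assms(1)] by (simp add: q_def)
    then have "\<alpha> * q = 1" using assms(1) by (cases "q = 0") simp_all
    then show ?thesis by (simp only: q_def)
  qed
  ultimately show False by simp
qed

section \<open>Digit streams against the order of the reals, and the criterion for the exceptional
  set\<close>

lemma alt_less_inf_enat: "alt_less_inf (smap enat b) (smap enat c) \<longleftrightarrow> alt_less_inf b c"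
proof -
  have "map enat xs = map enat ys \<longleftrightarrow> xs = ys" for xs ys
    by (rule inj_map_eq_map) (simp add: inj_def)
  then show ?thesis by (simp add: alt_less_inf_def)
qed

lemma smap_enat_eq: "smap enat b = smap enat c \<longleftrightarrow> b = c"
proof
  assume *: "smap enat b = smap enat c"
  show "b = c"
  proof (rule stream_eqI)
    fix n show "b !! n = c !! n"
      using arg_cong[OF *, of "\<lambda>s. s !! n"] by simp
  qed
qed simp

lemma alt_less_inf_stake:
  assumes "alt_less_inf b c"
  shows "\<exists>n. alt_less (stake n b) (stake n c)"
proof -
  obtain j where j: "stake j b = stake j c" "if even j then b !! j < c !! j else c !! j < b !! j"
    using assms unfolding alt_less_inf_def by blast
  have "alt_less (stake j b @ [b !! j]) (stake j c @ [c !! j])"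
    using j by (subst alt_less_append) (auto simp: alt_less_Cons)
  then show ?thesis by (intro exI[of _ "Suc j"]) (simp only: stake_Suc)
qed

lemma alt_less_inf_linear: "alt_less_inf b c \<or> b = c \<or> alt_less_inf c b" for b c :: "nat stream"
proof (rule ccontr)
  assume no: "\<not> ?thesis"
  then have ex: "\<exists>n. b !! n \<noteq> c !! n" using stream_eqI by blast
  define j where "j = (LEAST n. b !! n \<noteq> c !! n)"
  have j: "b !! j \<noteq> c !! j" unfolding j_def using ex by (rule LeastI_ex)
  have "b !! i = c !! i" if "i < j" for i
    using not_less_Least[of i "\<lambda>n. b !! n \<noteq> c !! n"] that by (simp add: j_def)
  then have "stake j b = stake j c" by (intro nth_equalityI) (simp_all add: stake_nth)
  then show False
    using no j unfolding alt_less_inf_def by (metis linorder_neqE_nat)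
qed

text \<open>Points with the same digits lie in the image of one branch of 2m digits, which has
  diameter at most \<open>(1/4) ^ m\<close>.\<close>

lemma digits_inj:
  assumes "y < 1" "z < 1" "\<And>n. 0 < (gauss ^^ n) y" "\<And>n. 0 < (gauss ^^ n) z" "digits y = digits z"
  shows "y = z"
proof -
  have pos: "0 < y" "0 < z" using assms(3)[of 0] assms(4)[of 0] by simp_all
  have "\<bar>y - z\<bar> \<le> (1/4) ^ m" for m
  proof -
    let ?q = "quots (2 * m) y"
    have q: "?q = quots (2 * m) z" using assms(5) stake_digits by metis
    have "rcf ?q ((gauss ^^ (2 * m)) y) = y" by (rule rcf_quots[OF assms(3)])
    moreover have "rcf ?q ((gauss ^^ (2 * m)) z) = z" unfolding q by (rule rcf_quots[OF assms(4)])
    ultimately have "\<bar>y - z\<bar> = \<bar>rcf ?q ((gauss ^^ (2 * m)) y) - rcf ?q ((gauss ^^ (2 * m)) z)\<bar>"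
      by simp
    also have "\<dots> \<le> (1/4) ^ (length ?q div 2) * \<bar>(gauss ^^ (2 * m)) y - (gauss ^^ (2 * m)) z\<bar>"
      using assms pos by (intro rcf_contraction_quarter pos_quots_quots less_imp_le) auto
    also have "\<dots> \<le> (1/4) ^ m * 1"
    proof (rule mult_mono)
      have "(gauss ^^ (2 * m)) y < 1" "(gauss ^^ (2 * m)) z < 1"
        "0 < (gauss ^^ (2 * m)) y" "0 < (gauss ^^ (2 * m)) z"
        using assms pos by (auto intro: funpow_gauss_bounds)
      then show "\<bar>(gauss ^^ (2 * m)) y - (gauss ^^ (2 * m)) z\<bar> \<le> 1" by linarith
    qed auto
    finally show ?thesis by simp
  qed
  moreover have "(\<lambda>m. (1/4::real) ^ m) \<longlonglongrightarrow> 0"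
    by (rule LIMSEQ_realpow_zero) auto
  ultimately have "\<bar>y - z\<bar> \<le> 0" by (intro LIMSEQ_le_const[of _ 0]) auto
  then show ?thesis by simp
qed

lemma digits_alt_less:
  assumes "y < 1" "z < 1" "\<And>n. 0 < (gauss ^^ n) y" "\<And>n. 0 < (gauss ^^ n) z"
    and "alt_less_inf (digits y) (digits z)"
  shows "z < y"
proof -
  obtain n where "alt_less (stake n (digits y)) (stake n (digits z))"
    using alt_less_inf_stake[OF assms(5)] by blast
  then have less: "alt_less (quots n y) (quots n z)" by (simp only: stake_digits)
  have pos: "0 < y" "0 < z" using assms(3)[of 0] assms(4)[of 0] by simp_all
  have "rcf (quots n z) ((gauss ^^ n) z) < rcf (quots n y) ((gauss ^^ n) y)"
    using assms pos
    by (intro rcf_alt_less[OF less] pos_quots_quots) (auto intro: funpow_gauss_bounds less_imp_le)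
  then show ?thesis using rcf_quots[OF assms(3)] rcf_quots[OF assms(4)] by simp
qed

lemma digits_alt_le_iff:
  assumes "y < 1" "z < 1" "\<And>n. 0 < (gauss ^^ n) y" "\<And>n. 0 < (gauss ^^ n) z"
  shows "alt_le_inf (smap enat (digits y)) (smap enat (digits z)) \<longleftrightarrow> z \<le> y"
proof -
  have "alt_le_inf (smap enat (digits y)) (smap enat (digits z)) \<longleftrightarrow>
      alt_less_inf (digits y) (digits z) \<or> digits y = digits z"
    unfolding alt_le_inf_def alt_less_inf_enat smap_enat_eq ..
  moreover have "z < y" if "alt_less_inf (digits y) (digits z)"
    using digits_alt_less[OF assms that] .
  moreover have "y < z" if "alt_less_inf (digits z) (digits y)"
    using digits_alt_less[OF assms(2,1,4,3) that] .
  moreover have "y = z" if "digits y = digits z"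
    using digits_inj[OF assms that] .
  ultimately show ?thesis
    using alt_less_inf_linear[of "digits y" "digits z"] by force
qed

lemma expansion_minus_one: "expansion 0 (- 1) = sconst (Dig (-1) 2)"
proof (rule stream_eqI)
  have T: "T 0 (- 1) = - 1" by (simp add: T_def)
  fix n
  have "(T 0 ^^ n) (- 1) = - 1" by (induction n) (simp_all add: T)
  then show "expansion 0 (- 1) !! n = sconst (Dig (-1) 2) !! n"
    by (simp add: expansion_snth letter_at_def)
qed

text \<open>The orbit of a rational point under \<open>T 0\<close> reaches the fixed point -1, from
  which only twos are emitted.\<close>

lemma char_seq_real_terminating:
  assumes \<alpha>: "0 < \<alpha>" "\<alpha> < 1" and zero: "(gauss ^^ m) \<alpha> = 0"
  shows "\<exists>b. b \<noteq> [] \<and> char_seq_real (\<alpha> - 1) = map enat b @- sconst \<infinity>"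
proof -
  define n where "n = (LEAST n. (gauss ^^ n) \<alpha> = 0)"
  have n0: "(gauss ^^ n) \<alpha> = 0" unfolding n_def by (rule LeastI[of _ m]) (rule zero)
  have "(gauss ^^ i) \<alpha> \<noteq> 0" if "i < n" for i
    using not_less_Least[of i "\<lambda>n. (gauss ^^ n) \<alpha> = 0"] that by (simp add: n_def)
  then have pos: "0 < (gauss ^^ i) \<alpha>" if "i < n" for i
    using that funpow_gauss_bounds(1)[OF \<alpha>, of i] by (simp add: less_le)
  define l where "l = quots n \<alpha>"
  have l: "pos_quots l" "rcf l 0 = \<alpha>" "length l = n"
    using pos_quots_quots[where n = n, OF \<alpha> pos] rcf_quots[where n = n and y = \<alpha>, OF pos] n0
    by (simp_all add: l_def)
  have "l \<noteq> []" using l(2) l(3) n0 \<alpha> by (cases "l = []") auto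
  moreover have "l \<noteq> [1]" using l(2) \<alpha> by auto
  ultimately obtain e where e: "twin l e" using ex_twin[OF l(1)] by blast
  have "rcf e 0 = \<alpha>" using rcf_twin[OF e, of 0] l(2) by simp
  \<comment> \<open>Among the two expansions of the rational the even one is chosen, so that the
    word consists of complete blocks and ends at 0 - 1 = -1.\<close>
  then have "\<exists>b. even (length b) \<and> pos_quots b \<and> b \<noteq> [] \<and> rcf b 0 = \<alpha>"
    using l \<open>l \<noteq> []\<close> twin_even[OF e] twin_pos_quots[OF e] twin_ne[OF e] by (cases "even n") auto
  then obtain b where b: "even (length b)" "pos_quots b" "b \<noteq> []" "rcf b 0 = \<alpha>" by blast
  have "follows 0 (rcf b 0 - 1) (word_of b) (0 - 1)"
    using b pos_quots_take_drop(2)[OF b(2)] by (intro follows_word_of rcf_nonneg) auto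
  then have "expansion 0 (\<alpha> - 1) = word_of b @- sconst (Dig (-1) 2)"
    by (simp only: follows_def b(4) expansion_minus_one diff_0)
  then have "char_seq_real (\<alpha> - 1) = map enat b @- sconst \<infinity>"
    unfolding char_seq_real_def using char_seq_inf_word_of_twos[OF b(1,2)] by (simp only:)
  then show ?thesis using b(3) by blast
qed

text \<open>The first entries decide, infinity against a finite number. Hence the criterion fails
  for every rational \<alpha>.\<close>

lemma not_alt_le_sconst_infinity:
  assumes "b \<noteq> []"
  shows "\<not> alt_le_inf (sconst \<infinity>) (map enat b @- sconst \<infinity>)"
proof -
  obtain x c where b: "b = x # c" using assms by (cases b) auto
  define S :: "enat stream" where "S = sconst \<infinity>"
  have S: "shd S = \<infinity>" by (simp add: S_def)
  let ?a = "map enat b @- S"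
  have a: "shd ?a = enat x" by (simp add: b)
  have "S \<noteq> ?a" using S a by (metis enat.distinct(1))
  moreover have "\<not> alt_less_inf S ?a"
  proof
    assume "alt_less_inf S ?a"
    then obtain j where j: "stake j S = stake j ?a" "if even j then S !! j < ?a !! j else ?a !! j < S !! j"
      unfolding alt_less_inf_def by blast
    show False
    proof (cases j)
      case 0
      then show ?thesis using j(2) S a by simp
    next
      case (Suc i)
      then have "shd S = shd ?a" using j(1) by simp
      then show ?thesis using S a by simp
    qed
  qed
  ultimately show ?thesis by (simp add: alt_le_inf_def S_def)
qed

lemma exceptional_iff_char_seq:
  "\<alpha> \<in> {0<..1} - Gam \<longleftrightarrow> \<alpha> \<in> {0<..gold} \<and>
     (\<forall>n\<ge>2. alt_le_inf (sdrop (n - 1) (char_seq_real (\<alpha> - 1))) (char_seq_real (\<alpha> - 1)))"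
    (is "_ \<longleftrightarrow> _ \<and> ?P")
proof (cases "0 < \<alpha> \<and> \<alpha> < 1")
  case False
  have "1 \<in> Gam"
    using not_Gam_iff[of 1] by (auto simp: gauss_def dest!: spec[of _ 1])
  then show ?thesis using False gold_mult by (cases "\<alpha> = 1") auto
next
  case True
  then have \<alpha>: "0 < \<alpha>" "\<alpha> < 1" by auto
  have lhs: "\<alpha> \<in> {0<..1} - Gam \<longleftrightarrow> (\<forall>n. \<alpha> \<le> (gauss ^^ n) \<alpha>)"
    using not_Gam_iff[of \<alpha>] \<alpha> by simp
  show ?thesis
  proof (cases "\<exists>m. (gauss ^^ m) \<alpha> = 0")
    case True
    then obtain m where m: "(gauss ^^ m) \<alpha> = 0" by blast
    then have "\<alpha> \<notin> {0<..1} - Gam" using lhs \<alpha> by (metis not_le)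
    moreover obtain b where b: "b \<noteq> []" "char_seq_real (\<alpha> - 1) = map enat b @- sconst \<infinity>"
      using char_seq_real_terminating[OF \<alpha> m] by blast
    have "\<not> alt_le_inf (sdrop (length b) (char_seq_real (\<alpha> - 1))) (char_seq_real (\<alpha> - 1))"
      using not_alt_le_sconst_infinity[OF b(1)] unfolding b(2) by (simp add: sdrop_shift)
    \<comment> \<open>The index n = |b| + 1 is at least 2, and the shift by n - 1 removes exactly
      the finite entries.\<close>
    then have "\<not> ?P"
      using b(1) by (auto intro!: exI[of _ "Suc (length b)"] simp: Suc_le_eq)
    ultimately show ?thesis by blast
  next
    case False
    then have pos: "0 < (gauss ^^ n) \<alpha>" for n
      using funpow_gauss_bounds(1)[OF \<alpha>, of n] by (metis less_le)
    have "expansion 0 (\<alpha> - 1) = word_of_inf (digits \<alpha>)"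
      using \<alpha> pos by (intro expansion_eq_word_of_inf) (auto intro: less_imp_le)
    then have cs: "char_seq_real (\<alpha> - 1) = smap enat (digits \<alpha>)"
      unfolding char_seq_real_def using char_seq_inf_word_of_inf[OF one_le_digits[OF \<alpha>(2) pos]] by simp
    have iff: "alt_le_inf (sdrop n (char_seq_real (\<alpha> - 1))) (char_seq_real (\<alpha> - 1)) \<longleftrightarrow>
        \<alpha> \<le> (gauss ^^ n) \<alpha>" for n
    proof -
      have "sdrop n (char_seq_real (\<alpha> - 1)) = smap enat (digits ((gauss ^^ n) \<alpha>))"
        unfolding cs by (simp add: sdrop_digits)
      moreover have "0 < (gauss ^^ i) ((gauss ^^ n) \<alpha>)" for i
        using pos[of "i + n"] by (simp add: funpow_add)
      ultimately show ?thesis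
        unfolding cs using pos \<alpha> funpow_gauss_bounds(2)[OF \<alpha>, of n]
        by (simp only:) (intro digits_alt_le_iff)
    qed
    have P: "?P \<longleftrightarrow> (\<forall>n. \<alpha> \<le> (gauss ^^ n) \<alpha>)"
    proof
      assume P: ?P
      show "\<forall>n. \<alpha> \<le> (gauss ^^ n) \<alpha>"
      proof
        fix n
        show "\<alpha> \<le> (gauss ^^ n) \<alpha>"
        proof (cases n)
          case (Suc k)
          then show ?thesis using P[rule_format, of "Suc n"] iff[of n] by simp
        qed simp
      qed
    qed (use iff in blast)
    have "\<alpha> \<le> gold" if "\<forall>n. \<alpha> \<le> (gauss ^^ n) \<alpha>"
      using exceptional_le_gold[of \<alpha>] that[rule_format, of 1] \<alpha> by simp
    then show ?thesis unfolding lhs P using \<alpha> by auto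
  qed
qed

lemma exceptional_upper:
  assumes "\<alpha> \<in> {0<..1} - Gam"
  shows "lower \<alpha> \<in> streams A_minus" "\<not> ends_with_twos (lower \<alpha>)"
    "upper \<alpha> = W_stream (hat_inf (lower \<alpha>))"
proof -
  have \<alpha>: "0 < \<alpha>" "\<alpha> \<le> 1" and orbit: "\<And>n. \<alpha> \<le> (gauss ^^ n) \<alpha>"
    using assms not_Gam_iff[of \<alpha>] by auto
  have "\<alpha> < 1" using orbit[of 1] gauss_bounds[of \<alpha>] by simp
  note lu = lower_upper_exceptional[OF \<alpha>(1) this orbit]
  note ge = one_le_digits[OF \<open>\<alpha> < 1\<close> positive_orbit[OF \<alpha>(1) orbit]]
  show "lower \<alpha> \<in> streams A_minus"
    unfolding lu(1) by (rule word_of_inf_in_streams)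
  show "\<not> ends_with_twos (lower \<alpha>)"
    unfolding lu(1) by (rule word_of_inf_not_ends_with_twos[OF ge])
  have "hat_inf (lower \<alpha>) = hat_word_of_inf (digits \<alpha>)"
    unfolding lu(1) hat_inf_def char_seq_inf_word_of_inf[OF ge]
    by (simp add: stream.map_comp o_def stream.map_ident)
  then show "upper \<alpha> = W_stream (hat_inf (lower \<alpha>))" using lu(2) by simp
qed

section \<open>Null sets of bounded quotients\<close>

lemma borel_measurable_gauss_funpow: "gauss ^^ n \<in> borel_measurable borel"
proof (induction n)
  case (Suc n)
  have "gauss = (\<lambda>y. 1 / y - real_of_int \<lfloor>1 / y\<rfloor>)"
    by (auto simp: gauss_def frac_def)
  moreover have "(\<lambda>y::real. 1 / y - real_of_int \<lfloor>1 / y\<rfloor>) \<in> borel_measurable borel"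
    by measurable
  ultimately have "gauss \<in> borel_measurable borel" by simp
  then show ?case using Suc by (simp add: measurable_comp)
qed (simp add: id_def)

lemma absolutely_integrable_on_unit_subset:
  fixes f :: "real \<Rightarrow> real"
  assumes "E \<in> sets lebesgue" "E \<subseteq> {0..1}" "continuous_on {0..1} f"
  shows "f absolutely_integrable_on E"
  using absolutely_integrable_continuous_real[OF assms(3)] assms(1,2)
  by (rule set_integrable_subset)

text \<open>The k-th summand is the density 1/(1 + y) pulled back along the branch y -> 1/(k +
  y).\<close>

lemma telescope_density:
  fixes y :: real
  assumes "0 < y"
  shows "(\<Sum>k=1..K. 1 / ((real k + y) * (real k + 1 + y))) = 1 / (1 + y) - 1 / (real K + 1 + y)"
proof (induction K)
  case (Suc K)
  have "1 / ((real (Suc K) + y) * (real (Suc K) + 1 + y))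
      = 1 / (real K + 1 + y) - 1 / (real (Suc K) + 1 + y)"
    using assms by (simp add: field_simps)
  then show ?case using Suc by simp
qed simp

lemma bounded_quotients_negligible:
  assumes "0 < c"
  shows "negligible {y \<in> {0<..<1}. \<forall>n. c \<le> (gauss ^^ n) y}"
proof -
  define E where "E = {y \<in> {0<..<1}. \<forall>n. c \<le> (gauss ^^ n) y}"
  \<comment> \<open>Points of \<open>E\<close> are at least \<open>c\<close> (the case n = 0), so
    their quotients are at most 1/c.\<close>
  define K where "K = nat \<lceil>1 / c\<rceil>"
  define \<phi> where "\<phi> k y = 1 / (real k + y)" for k y
  define h :: "real \<Rightarrow> real" where "h y = 1 / (1 + y)" for y
  have "{y. c \<le> (gauss ^^ n) y} \<in> sets borel" for n
    using borel_measurable_gauss_funpow[of n]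
    by (metis (no_types, lifting) borel_measurable_const borel_measurable_le space_borel UNIV_I Collect_cong)
  then have "{0<..<1} \<inter> (\<Inter>n. {y. c \<le> (gauss ^^ n) y}) \<in> sets borel"
    by (intro sets.Int sets.countable_INT') auto
  moreover have "{0<..<1} \<inter> (\<Inter>n. {y. c \<le> (gauss ^^ n) y}) = E"
    by (auto simp: E_def)
  ultimately have Eb: "E \<in> sets lebesgue" by auto
  have E01: "E \<subseteq> {0..1}" "\<And>y. y \<in> E \<Longrightarrow> 0 < y"
    by (auto simp: E_def)
  have "E \<in> lmeasurable"
    by (rule bounded_set_imp_lmeasurable) (use Eb E01 bounded_subset[OF bounded_closed_interval[of 0 "1::real"]] in auto)
  \<comment> \<open>\<open>E\<close> is forward invariant under \<open>gauss\<close>, and y is the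
    image of \<open>gauss y\<close> under the branch of its own first quotient.\<close>
  have cover: "\<exists>k\<in>{1..K}. y \<in> \<phi> k ` E" if "y \<in> E" for y
  proof -
    have y: "0 < y" "y < 1" "\<And>n. c \<le> (gauss ^^ n) y" using that by (auto simp: E_def)
    have "gauss y \<in> E"
    proof -
      have "c \<le> gauss y" using y(3)[of 1] by simp
      moreover have "c \<le> (gauss ^^ n) (gauss y)" for n
        using y(3)[of "Suc n"] by (simp add: funpow_swap1)
      ultimately show ?thesis using gauss_bounds[of y] assms by (simp add: E_def)
    qed
    moreover have "y = \<phi> (quot y) (gauss y)"
      using gauss_step[OF y(1)] by (simp add: \<phi>_def)
    moreover have "1 \<le> quot y" using quot_pos y by simp
    moreover have "quot y \<le> K"
    proof -
      have "1 / y \<le> 1 / c" using y(3)[of 0] assms by (simp add: frac_le)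
      then have "\<lfloor>1 / y\<rfloor> \<le> \<lceil>1 / c\<rceil>" by linarith
      then show ?thesis unfolding quot_def K_def by (rule nat_mono)
    qed
    ultimately show ?thesis by auto
  qed
  define g where "g k y = 1 / ((real k + y) * (real k + 1 + y))" for k y
  have int_g: "g k absolutely_integrable_on E" if "1 \<le> k" for k
    using that unfolding g_def
    by (intro absolutely_integrable_on_unit_subset[OF Eb E01(1)] continuous_intros) auto
  have int_h: "h absolutely_integrable_on E"
    unfolding h_def
    by (intro absolutely_integrable_on_unit_subset[OF Eb E01(1)] continuous_intros) auto
  have cov: "h absolutely_integrable_on \<phi> k ` E \<and> integral (\<phi> k ` E) h = integral E (g k)"
    if "1 \<le> k" for k
  proof -
    define \<phi>' where "\<phi>' y = - 1 / (real k + y)\<^sup>2" for y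
    have der: "(\<phi> k has_field_derivative \<phi>' y) (at y within E)" if "y \<in> E" for y
      unfolding \<phi>_def \<phi>'_def using E01(2)[OF that]
      by (auto intro!: derivative_eq_intros simp: power2_eq_square)
    have inj: "inj_on (\<phi> k) E"
      using E01(2) by (auto simp: inj_on_def \<phi>_def)
    have eq: "\<bar>\<phi>' y\<bar> * h (\<phi> k y) = g k y" if "y \<in> E" for y
    proof -
      define u where "u = real k + y"
      have u: "0 < u" "real k + 1 + y = u + 1" using E01(2)[OF that] by (simp_all add: u_def)
      have "h (\<phi> k y) = u / (u + 1)" unfolding h_def \<phi>_def u_def[symmetric]
        using u by (simp add: field_simps)
      moreover have "\<bar>\<phi>' y\<bar> = 1 / (u * u)"
        unfolding \<phi>'_def u_def[symmetric] by (simp add: power2_eq_square abs_mult)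
      ultimately show ?thesis
        unfolding g_def u(2) u_def[symmetric] using u(1) by simp
    qed
    have "(\<lambda>y. \<bar>\<phi>' y\<bar> * h (\<phi> k y)) absolutely_integrable_on E"
      using int_g[OF that] by (simp add: eq cong: set_integrable_cong)
    moreover have "integral E (\<lambda>y. \<bar>\<phi>' y\<bar> * h (\<phi> k y)) = integral E (g k)"
      by (rule integral_cong) (rule eq)
    ultimately show ?thesis
      using has_absolute_integral_change_of_variables_1'[OF Eb der inj, of h "integral E (g k)"] by blast
  qed
  \<comment> \<open>Extended by zero to the line, the cover becomes a pointwise bound: at y in
    \<open>E\<close> one summand already equals \<open>h y\<close>, and the others are
    nonnegative.\<close>
  let ?ind = "\<lambda>S y. if y \<in> S then h y else 0"
  have "integral E h = integral UNIV (?ind E)" by (simp add: integral_restrict_UNIV)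
  also have "\<dots> \<le> integral UNIV (\<lambda>y. \<Sum>k=1..K. ?ind (\<phi> k ` E) y)"
  proof (rule integral_le)
    show "?ind E integrable_on UNIV"
      using int_h by (simp add: integrable_restrict_UNIV set_lebesgue_integral_eq_integral(1))
    show "(\<lambda>y. \<Sum>k=1..K. ?ind (\<phi> k ` E) y) integrable_on UNIV"
      using cov by (intro integrable_sum) (auto simp: integrable_restrict_UNIV set_lebesgue_integral_eq_integral(1))
  next
    fix y :: real
    have nonneg: "0 \<le> ?ind (\<phi> k ` E) y" for k
      using E01(2) by (auto simp: h_def \<phi>_def less_imp_le)
    show "?ind E y \<le> (\<Sum>k=1..K. ?ind (\<phi> k ` E) y)"
    proof (cases "y \<in> E")
      case True
      then obtain k where k: "k \<in> {1..K}" "y \<in> \<phi> k ` E" using cover by blast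
      have "?ind E y = ?ind (\<phi> k ` E) y" using True k by simp
      also have "\<dots> \<le> (\<Sum>k=1..K. ?ind (\<phi> k ` E) y)"
        by (rule member_le_sum) (use k nonneg in auto)
      finally show ?thesis .
    next
      case False
      then show ?thesis using nonneg by (simp add: sum_nonneg)
    qed
  qed
  also have "\<dots> = (\<Sum>k=1..K. integral UNIV (?ind (\<phi> k ` E)))"
    using cov by (intro integral_sum) (auto simp: integrable_restrict_UNIV set_lebesgue_integral_eq_integral(1))
  also have "\<dots> = (\<Sum>k=1..K. integral E (g k))"
    using cov by (intro sum.cong) (auto simp: integral_restrict_UNIV)
  also have "\<dots> = integral E (\<lambda>y. \<Sum>k=1..K. g k y)"
    using int_g by (intro integral_sum[symmetric]) (auto simp: set_lebesgue_integral_eq_integral(1))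
  also have "\<dots> = integral E (\<lambda>y. h y - 1 / (real K + 1 + y))"
    using telescope_density E01(2) by (intro integral_cong) (simp add: g_def h_def)
  also have "\<dots> = integral E h - integral E (\<lambda>y. 1 / (real K + 1 + y))"
  proof (rule integral_diff)
    show "h integrable_on E" using int_h by (simp add: set_lebesgue_integral_eq_integral(1))
    show "(\<lambda>y. 1 / (real K + 1 + y)) integrable_on E"
      by (intro set_lebesgue_integral_eq_integral(1) absolutely_integrable_on_unit_subset[OF Eb E01(1)] continuous_intros) auto
  qed
  \<comment> \<open>The finite mass of \<open>E\<close> stands at both ends of the chain and
    cancels.\<close>
  finally have le0: "integral E (\<lambda>y. 1 / (real K + 1 + y)) \<le> 0" by simp
  \<comment> \<open>As y \<le> 1 on \<open>E\<close>, the integrand is at least 1/(K + 2), a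
    positive constant, so the measure must vanish.\<close>
  have "integral E (\<lambda>y. 1 / (real K + 2)) \<le> integral E (\<lambda>y. 1 / (real K + 1 + y))"
  proof (rule integral_le)
    show "(\<lambda>y. 1 / (real K + 2)) integrable_on E" "(\<lambda>y. 1 / (real K + 1 + y)) integrable_on E"
      by (intro set_lebesgue_integral_eq_integral(1) absolutely_integrable_on_unit_subset[OF Eb E01(1)] continuous_intros; auto)+
    show "1 / (real K + 2) \<le> 1 / (real K + 1 + y)" if "y \<in> E" for y
      using that E01 by (intro divide_left_mono) (auto intro!: mult_pos_pos add_nonneg_pos)
  qed
  moreover have "integral E (\<lambda>y. 1 / (real K + 2)) = 1 / (real K + 2) * measure lebesgue E"
    using integral_mult_right[of E "1 / (real K + 2)" "\<lambda>_. 1::real"] lmeasure_integral[OF \<open>E \<in> lmeasurable\<close>] by simp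
  ultimately have "1 / (real K + 2) * measure lebesgue E \<le> 0" using le0 by linarith
  moreover have "0 < 1 / (real K + 2)" by simp
  ultimately have "measure lebesgue E \<le> 0"
    by (metis mult_le_0_iff not_less)
  then have "measure lebesgue E = 0" by (simp add: order_antisym)
  then show ?thesis
    using \<open>E \<in> lmeasurable\<close> unfolding E_def[symmetric] by (simp add: negligible_iff_measure)
qed

text \<open>An exceptional \<alpha> is itself a lower bound of its orbit; bounds of the form 1/(k +
  1) give a countable cover by null sets.\<close>

lemma exceptional_null_set: "{0<..1} - Gam \<in> null_sets lebesgue"
proof -
  define E where "E k = {y \<in> {0<..<1}. \<forall>n. 1 / (real k + 1) \<le> (gauss ^^ n) y}" for k :: nat
  have "{0<..1} - Gam \<subseteq> (\<Union>k. E k)"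
  proof
    fix \<alpha> assume "\<alpha> \<in> {0<..1} - Gam"
    then have \<alpha>: "0 < \<alpha>" "\<alpha> \<le> 1" and orbit: "\<And>n. \<alpha> \<le> (gauss ^^ n) \<alpha>"
      using not_Gam_iff[of \<alpha>] by auto
    have "\<alpha> < 1" using orbit[of 1] gauss_bounds[of \<alpha>] by simp
    obtain k where "inverse (real (Suc k)) < \<alpha>"
      using reals_Archimedean[OF \<alpha>(1)] by blast
    then have "1 / (real k + 1) \<le> \<alpha>" by (simp add: inverse_eq_divide add.commute)
    then have "1 / (real k + 1) \<le> (gauss ^^ n) \<alpha>" for n using orbit[of n] by linarith
    then have "\<alpha> \<in> E k" using \<alpha> \<open>\<alpha> < 1\<close> by (simp add: E_def)
    then show "\<alpha> \<in> (\<Union>k. E k)" by blast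
  qed
  moreover have "negligible (E k)" for k
    unfolding E_def by (rule bounded_quotients_negligible) simp
  then have "negligible (\<Union>k. E k)"
    by (intro negligible_countable_Union) auto
  ultimately show ?thesis
    using negligible_subset negligible_iff_null_sets by blast
qed

theorem theorem5:
  shows "(Gam = (\<Union>v\<in>F. Gam_word v) \<and> disjoint_family_on Gam_word F)
    \<and> (\<forall>v\<in>F. \<forall>\<alpha>\<in>Gam_word v.
          stake (length v) (lower \<alpha>) = v
        \<and> stake (length (hat v)) (upper \<alpha>) = W_word (shift_last (-1) (hat v))
        \<and> upper \<alpha> !! length (hat v) = W (lower \<alpha> !! length v)
        \<and> (T \<alpha> ^^ (length v + 1)) (\<alpha> - 1) = (T \<alpha> ^^ (length (hat v) + 1)) \<alpha>)
    \<and> (\<forall>\<alpha>. \<alpha> \<in> {0<..1} - Gam \<longleftrightarrow>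
          \<alpha> \<in> {0<..gold} \<and>
          (\<forall>n\<ge>2. alt_le_inf (sdrop (n - 1) (char_seq_real (\<alpha> - 1))) (char_seq_real (\<alpha> - 1))))
    \<and> ({0<..1} - Gam \<in> null_sets lebesgue \<and>
       (\<forall>\<alpha>\<in>{0<..1} - Gam.
          lower \<alpha> \<in> streams A_minus \<and> \<not> ends_with_twos (lower \<alpha>) \<and>
          upper \<alpha> = W_stream (hat_inf (lower \<alpha>))))"
proof (intro conjI)
  have "Gam \<subseteq> (\<Union>v\<in>F. Gam_word v)"
  proof
    fix \<alpha> assume "\<alpha> \<in> Gam"
    moreover from this have \<alpha>: "0 < \<alpha>" "\<alpha> \<le> 1" by (auto simp: Gam_def)
    ultimately obtain n where "(gauss ^^ n) \<alpha> < \<alpha>"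
      using not_Gam_iff[OF \<alpha>] by (auto simp: not_le)
    then show "\<alpha> \<in> (\<Union>v\<in>F. Gam_word v)" using ex_Gam_word[OF \<alpha>] by blast
  qed
  then show "Gam = (\<Union>v\<in>F. Gam_word v)" using Gam_word_subset_Gam by blast
next
  show "disjoint_family_on Gam_word F" by (rule disjoint_Gam_word)
next
  show "\<forall>v\<in>F. \<forall>\<alpha>\<in>Gam_word v.
          stake (length v) (lower \<alpha>) = v
        \<and> stake (length (hat v)) (upper \<alpha>) = W_word (shift_last (-1) (hat v))
        \<and> upper \<alpha> !! length (hat v) = W (lower \<alpha> !! length v)
        \<and> (T \<alpha> ^^ (length v + 1)) (\<alpha> - 1) = (T \<alpha> ^^ (length (hat v) + 1)) \<alpha>"
    by (intro ballI conjI matching_properties)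
next
  show "\<forall>\<alpha>. \<alpha> \<in> {0<..1} - Gam \<longleftrightarrow>
          \<alpha> \<in> {0<..gold} \<and>
          (\<forall>n\<ge>2. alt_le_inf (sdrop (n - 1) (char_seq_real (\<alpha> - 1))) (char_seq_real (\<alpha> - 1)))"
    by (rule allI) (rule exceptional_iff_char_seq)
next
  show "{0<..1} - Gam \<in> null_sets lebesgue" by (rule exceptional_null_set)
next
  show "\<forall>\<alpha>\<in>{0<..1} - Gam.
          lower \<alpha> \<in> streams A_minus \<and> \<not> ends_with_twos (lower \<alpha>) \<and>
          upper \<alpha> = W_stream (hat_inf (lower \<alpha>))"
    by (intro ballI conjI exceptional_upper)
qed

end
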